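(* Equip $\mathbb{S}^3\times\mathbb{S}^3$ with the nearly Kähler metric $g$ and the almost product structure $P$. Let $\gamma=(x,y):\mathbb{R}\to\mathbb{S}^3\times\mathbb{S}^3$ be a non-constant geodesic of $(\mathbb{S}^3\times\mathbb{S}^3,g)$, with associated data $c_1$ and, when $c_1\neq0$, $d_1$, $c_2$ and the constants $a,\tilde a,A,B,\tilde A,\tilde B$, as defined in the context. Then: (1) $\gamma$ is also a geodesic of the usual Euclidean product metric on $\mathbb{S}^3\times\mathbb{S}^3$ if and only if $c_1=0$ or $c_2=0$. (2) The tangent vector satisfies $P\gamma'=-\gamma'$ (along $\gamma$) if and only if $c_1=0$; it satisfies $P\gamma'=\gamma'$ (along $\gamma$) if and only if $c_1\neq0$, $c_2=0$ and $d_1=0$. (3) $\gamma$ is closed if and only if one of the following holds: (i) $c_1=0$; (ii) $c_1\neq0$, $c_2=0$ and the fraction $\frac{a}{\tilde a}$ is a rational number; (iii) $c_1\neq0$, $c_2\neq0$ and both fractions $\frac{B}{A}$ and $\frac{\tilde B}{\tilde A}$ are rational numbers. Here, if one of the two constants appearing in a fraction is $0$, the rationality condition on that fraction is regarded as satisfied.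
   Context: $\mathbb{H}$ denotes the quaternions with imaginary units $i,j,k$, $\mathrm{Im}\,\mathbb{H}$ the imaginary quaternions, and $\|\cdot\|$, $\langle\cdot,\cdot\rangle$ the Euclidean norm and inner product on $\mathbb{H}\cong\mathbb{R}^4$. $\mathbb{S}^3$ is the set of unit quaternions, and $T_p\mathbb{S}^3=p\,\mathrm{Im}\,\mathbb{H}$. Tangent vectors of $\mathbb{S}^3\times\mathbb{S}^3$ at $(p,q)$ are written $Z=(U,V)$ with $U\in T_p\mathbb{S}^3$, $V\in T_q\mathbb{S}^3$. The nearly Kähler structure on $\mathbb{S}^3\times\mathbb{S}^3$ consists of the almost complex structure $J(U,V)_{(p,q)}=\frac{1}{\sqrt3}(2pq^{-1}V-U,\,-2qp^{-1}U+V)$ and the Riemannian metric $$g(Z,Z')=\tfrac12\big(\langle Z,Z'\rangle+\langle JZ,JZ'\rangle\big)=\tfrac43\big(\langle U,U'\rangle+\langle V,V'\rangle\big)-\tfrac23\big(\langle p^{-1}U,q^{-1}V'\rangle+\langle p^{-1}U',q^{-1}V\rangle\big)$$ for $Z=(U,V)$, $Z'=(U',V')$ in $T_{(p,q)}(\mathbb{S}^3\times\mathbb{S}^3)$, where $\langle Z,Z'\rangle$ is the Euclidean product metric. The almost product structure $P$ is $PZ=(pq^{-1}V,\,qp^{-1}U)$ for $Z=(U,V)\in T_{(p,q)}(\mathbb{S}^3\times\mathbb{S}^3)$. Geodesics are taken with affine (not necessarily unit-speed) parameter; a geodesic $\gamma:\mathbb{R}\to\mathbb{S}^3\times\mathbb{S}^3$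 is closed if it is a periodic function of its parameter. Data of a geodesic. For a geodesic $\gamma=(x,y)$ of $g$ write $\gamma'(t)=(x(t)\alpha(t),y(t)\beta(t))$ with $\alpha,\beta:\mathbb{R}\to\mathrm{Im}\,\mathbb{H}$. Put $c_1=\alpha(0)+\beta(0)\in\mathrm{Im}\,\mathbb{H}$. If $c_1\neq0$, put $$d_1=\frac{\langle\alpha(0)-\beta(0),c_1\rangle}{\|c_1\|^2}\in\mathbb{R},\qquad c_2=\alpha(0)-\beta(0)-d_1c_1\in\mathrm{Im}\,\mathbb{H},$$ and define $$a=\tfrac{1+d_1}{2}\|c_1\|,\quad \tilde a=\tfrac{1-d_1}{2}\|c_1\|,\quad b=\tfrac12\|c_2\|,\quad \tilde b=-\tfrac12\|c_2\|,\quad c=\tilde c=\tfrac23\|c_1\|,$$ $$A=\frac{c+\sqrt{(2a-c)^2+4b^2}}{2},\quad B=\frac{c-\sqrt{(2a-c)^2+4b^2}}{2},$$ $$\tilde A=\frac{\tilde c+\sqrt{(2\tilde a-\tilde c)^2+4\tilde b^2}}{2},\quad \tilde B=\frac{\tilde c-\sqrt{(2\tilde a-\tilde c)^2+4\tilde b^2}}{2}.$$ The condition "$c_2=0$" is only considered when $c_1\neq0$. *)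

theory Defs
  imports "HOL-Analysis.Analysis"
begin

section \<open>Quaternions\<close>

codatatype quat = Quat (qRe: real) (qI: real) (qJ: real) (qK: real)

lemma quat_eqI [intro?]:
  "qRe x = qRe y \<Longrightarrow> qI x = qI y \<Longrightarrow> qJ x = qJ y \<Longrightarrow> qK x = qK y \<Longrightarrow> x = y"
  by (rule quat.expand) simp

lemma quat_eq_iff:
  "x = y \<longleftrightarrow> qRe x = qRe y \<and> qI x = qI y \<and> qJ x = qJ y \<and> qK x = qK y"
  by (auto intro: quat.expand)

instantiation quat :: ab_group_add
begin

primcorec zero_quat where
  "qRe 0 = 0" | "qI 0 = 0" | "qJ 0 = 0" | "qK 0 = 0"

primcorec plus_quat where
  "qRe (x + y) = qRe x + qRe y"
| "qI (x + y) = qI x + qI y"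
| "qJ (x + y) = qJ x + qJ y"
| "qK (x + y) = qK x + qK y"

primcorec uminus_quat where
  "qRe (- x) = - qRe x"
| "qI (- x) = - qI x"
| "qJ (- x) = - qJ x"
| "qK (- x) = - qK x"

primcorec minus_quat where
  "qRe (x - y) = qRe x - qRe y"
| "qI (x - y) = qI x - qI y"
| "qJ (x - y) = qJ x - qJ y"
| "qK (x - y) = qK x - qK y"

instance
  by standard (simp_all add: quat_eq_iff)

end

instantiation quat :: real_vector
begin

primcorec scaleR_quat where
  "qRe (scaleR r x) = r * qRe x"
| "qI (scaleR r x) = r * qI x"
| "qJ (scaleR r x) = r * qJ x"
| "qK (scaleR r x) = r * qK x"

instance
  by standard (auto simp: quat_eq_iff distrib_left distrib_right)

end

instantiation quat :: ring_1
begin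

primcorec one_quat where
  "qRe 1 = 1" | "qI 1 = 0" | "qJ 1 = 0" | "qK 1 = 0"

primcorec times_quat where
  "qRe (x * y) = qRe x * qRe y - qI x * qI y - qJ x * qJ y - qK x * qK y"
| "qI (x * y) = qRe x * qI y + qI x * qRe y + qJ x * qK y - qK x * qJ y"
| "qJ (x * y) = qRe x * qJ y - qI x * qK y + qJ x * qRe y + qK x * qI y"
| "qK (x * y) = qRe x * qK y + qI x * qJ y - qJ x * qI y + qK x * qRe y"

instance
  by standard (auto simp: quat_eq_iff algebra_simps)

end

instantiation quat :: real_inner
begin

definition inner_quat_def:
  "inner x y = qRe x * qRe y + qI x * qI y + qJ x * qJ y + qK x * qK y"

definition norm_quat_def:
  "norm x = sqrt (inner x (x :: quat))"

definition sgn_quat_def: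
  "sgn x = x /\<^sub>R norm (x :: quat)"

definition dist_quat_def:
  "dist x y = norm (x - y :: quat)"

definition uniformity_quat_def [code del]:
  "(uniformity :: (quat \<times> quat) filter) = (INF e\<in>{0 <..}. principal {(x, y). dist x y < e})"

definition open_quat_def [code del]:
  "open (U :: quat set) \<longleftrightarrow> (\<forall>x\<in>U. eventually (\<lambda>(x', y). x' = x \<longrightarrow> y \<in> U) uniformity)"

instance
proof
  fix x y z :: quat and r :: real
  show "inner x y = inner y x"
    by (simp add: inner_quat_def mult.commute)
  show "inner (x + y) z = inner x z + inner y z"
    by (simp add: inner_quat_def distrib_right)
  show "inner (scaleR r x) y = r * inner x y"
    by (simp add: inner_quat_def distrib_left)
  show "0 \<le> inner x x"
    by (simp add: inner_quat_def)
  show "inner x x = 0 \<longleftrightarrow> x = 0"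
    by (simp add: inner_quat_def quat_eq_iff add_nonneg_eq_0_iff)
qed (rule norm_quat_def sgn_quat_def dist_quat_def open_quat_def uniformity_quat_def)+

end

lemma norm_quat_squared: "(norm x)\<^sup>2 = (qRe x)\<^sup>2 + (qI x)\<^sup>2 + (qJ x)\<^sup>2 + (qK x)\<^sup>2"
  for x :: quat
  by (simp add: norm_quat_def inner_quat_def power2_eq_square)

instantiation quat :: real_normed_div_algebra
begin

primcorec inverse_quat where
  "qRe (inverse x) = qRe x / (norm x)\<^sup>2"
| "qI (inverse x) = - (qI x) / (norm x)\<^sup>2"
| "qJ (inverse x) = - (qJ x) / (norm x)\<^sup>2"
| "qK (inverse x) = - (qK x) / (norm x)\<^sup>2"

definition divide_quat_def: "x div y = x * inverse y" for x y :: quat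

instance
proof
  fix x y :: quat and r :: real
  define cnj where "cnj = Quat (qRe x) (- qI x) (- qJ x) (- qK x)"
  have inv: "inverse x = (1 / (norm x)\<^sup>2) *\<^sub>R cnj"
    by (simp add: quat_eq_iff cnj_def)
  show ml: "scaleR r x * y = scaleR r (x * y)" for r and x y :: quat
    by (simp add: quat_eq_iff algebra_simps)
  show mr: "x * scaleR r y = scaleR r (x * y)" for r and x y :: quat
    by (simp add: quat_eq_iff algebra_simps)
  show "inverse x * x = 1" if "x \<noteq> 0"
  proof -
    have "cnj * x = (norm x)\<^sup>2 *\<^sub>R 1"
      by (simp add: quat_eq_iff cnj_def norm_quat_squared) (simp add: power2_eq_square algebra_simps)
    then show ?thesis
      using that by (simp add: inv ml mr)
  qed
  show "x * inverse x = 1" if "x \<noteq> 0"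
  proof -
    have "x * cnj = (norm x)\<^sup>2 *\<^sub>R 1"
      by (simp add: quat_eq_iff cnj_def norm_quat_squared) (simp add: power2_eq_square algebra_simps)
    then show ?thesis
      using that by (simp add: inv ml mr)
  qed
  show "x div y = x * inverse y"
    by (rule divide_quat_def)
  show "inverse (0 :: quat) = 0"
    by (simp add: quat_eq_iff)
  have "(norm (x * y))\<^sup>2 = (norm x * norm y)\<^sup>2"
    by (simp add: norm_quat_squared power_mult_distrib) (simp add: power2_eq_square algebra_simps)
  then show "norm (x * y) = norm x * norm y"
    by (simp add: power2_eq_iff_nonneg)
qed

end

definition quat_i :: quat where "quat_i = Quat 0 1 0 0"
definition quat_j :: quat where "quat_j = Quat 0 0 1 0"
definition quat_k :: quat where "quat_k = Quat 0 0 0 1"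

lemma quat_unit_sel [simp]:
  "qRe quat_i = 0" "qI quat_i = 1" "qJ quat_i = 0" "qK quat_i = 0"
  "qRe quat_j = 0" "qI quat_j = 0" "qJ quat_j = 1" "qK quat_j = 0"
  "qRe quat_k = 0" "qI quat_k = 0" "qJ quat_k = 0" "qK quat_k = 1"
  by (simp_all add: quat_i_def quat_j_def quat_k_def)

lemma quat_units:
  "quat_i * quat_i = -1" "quat_j * quat_j = -1" "quat_k * quat_k = -1"
  "quat_i * quat_j = quat_k" "quat_j * quat_k = quat_i" "quat_k * quat_i = quat_j"
  by (simp_all add: quat_eq_iff)

instantiation quat :: euclidean_space
begin

definition Basis_quat_def: "Basis = {1, quat_i, quat_j, quat_k}"

instance
proof
  fix u v :: quat
  assume "u \<in> Basis" "v \<in> Basis"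
  then show "inner u v = (if u = v then 1 else 0)"
    unfolding Basis_quat_def
    by (elim insertE emptyE; hypsubst; simp add: inner_quat_def quat_eq_iff)
next
  fix x :: quat
  show "(\<forall>u\<in>Basis. inner x u = 0) \<longleftrightarrow> x = 0"
    by (simp add: Basis_quat_def inner_quat_def) (auto simp: quat_eq_iff)
qed (simp_all add: Basis_quat_def)

end

definition ImH :: "quat set"
  where "ImH = {u. qRe u = 0}"


section \<open>The manifold \<open>S\<^sup>3 \<times> S\<^sup>3\<close>\<close>

definition S3xS3 :: "(quat \<times> quat) set"
  where "S3xS3 = sphere 0 1 \<times> sphere 0 1"

definition tangent :: "quat \<times> quat \<Rightarrow> (quat \<times> quat) set"
  where "tangent = (\<lambda>(p, q). {(p * u, q * v) |u v. u \<in> ImH \<and> v \<in> ImH})"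

text \<open>Only used for open sets \<open>S\<close>.\<close>

primrec Ck_on :: "nat \<Rightarrow> 'a::real_normed_vector set \<Rightarrow> ('a \<Rightarrow> 'b::real_normed_vector) \<Rightarrow> bool" where
  "Ck_on 0 S f \<longleftrightarrow> continuous_on S f"
| "Ck_on (Suc n) S f \<longleftrightarrow>
     (\<forall>x\<in>S. f differentiable (at x)) \<and> (\<forall>v. Ck_on n S (\<lambda>x. frechet_derivative f (at x) v))"

definition smooth_on :: "'a::real_normed_vector set \<Rightarrow> ('a \<Rightarrow> 'b::real_normed_vector) \<Rightarrow> bool"
  where "smooth_on S f \<longleftrightarrow> (\<forall>n. Ck_on n S f)"

text \<open>Functions and vector fields on \<open>S\<^sup>3 \<times> S\<^sup>3\<close> are total functions on the ambient space
  \<open>\<H> \<times> \<H>\<close> of which only the values on \<open>S\<^sup>3 \<times> S\<^sup>3\<close> matter; smoothness means existence of a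
  smooth extension to an open neighbourhood.\<close>

definition smooth_fun :: "(quat \<times> quat \<Rightarrow> 'b::real_normed_vector) \<Rightarrow> bool"
  where "smooth_fun f \<longleftrightarrow>
    (\<exists>U F. open U \<and> S3xS3 \<subseteq> U \<and> smooth_on U F \<and> (\<forall>p\<in>S3xS3. F p = f p))"

definition vector_fields :: "(quat \<times> quat \<Rightarrow> quat \<times> quat) set"
  where "vector_fields = {X. smooth_fun X \<and> (\<forall>p\<in>S3xS3. X p \<in> tangent p)}"

text \<open>Derivative of \<open>f\<close> at \<open>p\<close> in the direction of the tangent vector \<open>v\<close>. The derivative within
  \<open>S3xS3\<close> is determined only on tangent vectors, and it is only applied to those.\<close>

definition dir_deriv :: "(quat \<times> quat \<Rightarrow> 'b::real_normed_vector) \<Rightarrow> quat \<times> quat \<Rightarrow> quat \<times> quat \<Rightarrow> 'b"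
  where "dir_deriv f p v = frechet_derivative f (at p within S3xS3) v"

definition lie_bracket ::
  "(quat \<times> quat \<Rightarrow> quat \<times> quat) \<Rightarrow> (quat \<times> quat \<Rightarrow> quat \<times> quat) \<Rightarrow> quat \<times> quat \<Rightarrow> quat \<times> quat"
  where "lie_bracket X Y p = dir_deriv Y p (X p) - dir_deriv X p (Y p)"


section \<open>Levi-Civita connection and geodesics\<close>

type_synonym metric = "quat \<times> quat \<Rightarrow> quat \<times> quat \<Rightarrow> quat \<times> quat \<Rightarrow> real"

type_synonym connection =
  "(quat \<times> quat \<Rightarrow> quat \<times> quat) \<Rightarrow> (quat \<times> quat \<Rightarrow> quat \<times> quat) \<Rightarrow> quat \<times> quat \<Rightarrow> quat \<times> quat"

definition affine_connection :: "connection \<Rightarrow> bool"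
  where "affine_connection N \<longleftrightarrow>
    (\<forall>X\<in>vector_fields. \<forall>Y\<in>vector_fields. N X Y \<in> vector_fields) \<and>
    (\<forall>X\<in>vector_fields. \<forall>X'\<in>vector_fields. \<forall>Y\<in>vector_fields. \<forall>p\<in>S3xS3.
       N (\<lambda>p. X p + X' p) Y p = N X Y p + N X' Y p) \<and>
    (\<forall>f. smooth_fun f \<longrightarrow> (\<forall>X\<in>vector_fields. \<forall>Y\<in>vector_fields. \<forall>p\<in>S3xS3.
       N (\<lambda>p. f p *\<^sub>R X p) Y p = f p *\<^sub>R N X Y p)) \<and>
    (\<forall>X\<in>vector_fields. \<forall>Y\<in>vector_fields. \<forall>Y'\<in>vector_fields. \<forall>p\<in>S3xS3.
       N X (\<lambda>p. Y p + Y' p) p = N X Y p + N X Y' p) \<and>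
    (\<forall>f. smooth_fun f \<longrightarrow> (\<forall>X\<in>vector_fields. \<forall>Y\<in>vector_fields. \<forall>p\<in>S3xS3.
       N X (\<lambda>p. f p *\<^sub>R Y p) p = dir_deriv f p (X p) *\<^sub>R Y p + f p *\<^sub>R N X Y p))"

definition levi_civita :: "metric \<Rightarrow> connection \<Rightarrow> bool"
  where "levi_civita g N \<longleftrightarrow> affine_connection N \<and>
    (\<forall>X\<in>vector_fields. \<forall>Y\<in>vector_fields. \<forall>p\<in>S3xS3.
       N X Y p - N Y X p = lie_bracket X Y p) \<and>
    (\<forall>X\<in>vector_fields. \<forall>Y\<in>vector_fields. \<forall>Z\<in>vector_fields. \<forall>p\<in>S3xS3.
       dir_deriv (\<lambda>p. g p (Y p) (Z p)) p (X p) = g p (N X Y p) (Z p) + g p (Y p) (N X Z p))"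

definition smooth_curve :: "(real \<Rightarrow> quat \<times> quat) \<Rightarrow> bool"
  where "smooth_curve \<gamma> \<longleftrightarrow> smooth_on UNIV \<gamma> \<and> range \<gamma> \<subseteq> S3xS3"

definition velocity :: "(real \<Rightarrow> quat \<times> quat) \<Rightarrow> real \<Rightarrow> quat \<times> quat"
  where "velocity \<gamma> t = vector_derivative \<gamma> (at t)"

definition fields_along :: "(real \<Rightarrow> quat \<times> quat) \<Rightarrow> (real \<Rightarrow> quat \<times> quat) set"
  where "fields_along \<gamma> = {V. smooth_on UNIV V \<and> (\<forall>t. V t \<in> tangent (\<gamma> t))}"

definition covariant_derivative_along ::
  "connection \<Rightarrow> (real \<Rightarrow> quat \<times> quat) \<Rightarrow> ((real \<Rightarrow> quat \<times> quat) \<Rightarrow> real \<Rightarrow> quat \<times> quat) \<Rightarrow> bool"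
  where "covariant_derivative_along N \<gamma> D \<longleftrightarrow>
    (\<forall>V\<in>fields_along \<gamma>. D V \<in> fields_along \<gamma>) \<and>
    (\<forall>V\<in>fields_along \<gamma>. \<forall>W\<in>fields_along \<gamma>. \<forall>t. D (\<lambda>t. V t + W t) t = D V t + D W t) \<and>
    (\<forall>f. smooth_on UNIV f \<longrightarrow> (\<forall>V\<in>fields_along \<gamma>. \<forall>t.
       D (\<lambda>t. f t *\<^sub>R V t) t = deriv f t *\<^sub>R V t + f t *\<^sub>R D V t)) \<and>
    (\<forall>X\<in>vector_fields. \<forall>Y\<in>vector_fields. \<forall>t. X (\<gamma> t) = velocity \<gamma> t \<longrightarrow>
       D (\<lambda>t. Y (\<gamma> t)) t = N X Y (\<gamma> t))"

text \<open>For a Riemannian metric \<open>g\<close> the Levi-Civita connection and its covariant derivative along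
  \<open>\<gamma>\<close> exist and are unique, so the existential quantifiers below merely name them.\<close>

definition geodesic :: "metric \<Rightarrow> (real \<Rightarrow> quat \<times> quat) \<Rightarrow> bool"
  where "geodesic g \<gamma> \<longleftrightarrow> smooth_curve \<gamma> \<and>
    (\<exists>N D. levi_civita g N \<and> covariant_derivative_along N \<gamma> D \<and> (\<forall>t. D (velocity \<gamma>) t = 0))"

definition closed_curve :: "(real \<Rightarrow> quat \<times> quat) \<Rightarrow> bool"
  where "closed_curve \<gamma> \<longleftrightarrow> (\<exists>T>0. \<forall>t. \<gamma> (t + T) = \<gamma> t)"


section \<open>The nearly Kaehler structure\<close>

definition nK_J :: "quat \<times> quat \<Rightarrow> quat \<times> quat \<Rightarrow> quat \<times> quat"
  where "nK_J = (\<lambda>(p, q) (U, V).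
    (1 / sqrt 3) *\<^sub>R (2 * p * inverse q * V - U, - 2 * q * inverse p * U + V))"

definition eucl_product_metric :: metric
  where "eucl_product_metric m Z Z' = inner Z Z'"

definition nK_metric :: metric
  where "nK_metric m Z Z' = 1 / 2 * (inner Z Z' + inner (nK_J m Z) (nK_J m Z'))"

definition nK_P :: "quat \<times> quat \<Rightarrow> quat \<times> quat \<Rightarrow> quat \<times> quat"
  where "nK_P = (\<lambda>(p, q) (U, V). (p * inverse q * V, q * inverse p * U))"

lemma inner_quat_mult_left: "inner (a * x) (a * y) = (norm a)\<^sup>2 * inner x y" for a x y :: quat
  by (simp add: norm_quat_squared inner_quat_def) (simp add: power2_eq_square algebra_simps)

lemma nK_metric_explicit:
  assumes "(p, q) \<in> S3xS3"
  shows "nK_metric (p, q) (U, V) (U', V') =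
    4 / 3 * (inner U U' + inner V V')
    - 2 / 3 * (inner (inverse p * U) (inverse q * V') + inner (inverse p * U') (inverse q * V))"
proof -
  have n: "norm p = 1" "norm q = 1" and nz: "p \<noteq> 0" "q \<noteq> 0"
    using assms by (auto simp: S3xS3_def)
  define W W' where "W = inverse q * V" and "W' = inverse q * V'"
  define X X' where "X = inverse p * U" and "X' = inverse p * U'"
  have UV: "V = q * W" "V' = q * W'" "U = p * X" "U' = p * X'"
    using nz by (simp_all add: W_def W'_def X_def X'_def mult.assoc [symmetric])
  have two: "2 * z = (2::real) *\<^sub>R z" for z :: quat
    by (simp add: scaleR_2 mult_2)
  have J: "nK_J (p, q) (p * A, q * B) =
      (1 / sqrt 3) *\<^sub>R (p * (2 *\<^sub>R B - A), q * (B - 2 *\<^sub>R A))" for A B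
  proof -
    have "inverse q * (q * B) = B" "inverse p * (p * A) = A"
      using nz by (simp_all add: mult.assoc [symmetric])
    then show ?thesis
      by (simp add: nK_J_def mult.assoc two right_diff_distrib)
  qed
  have s: "1 / sqrt 3 * (1 / sqrt 3 * z) = z / 3" for z :: real
    by simp
  have i: "inner (c *\<^sub>R z) (c *\<^sub>R w) = c * (c * inner z w)" for c and z w :: "quat \<times> quat"
    by simp
  have "nK_metric (p, q) (p * X, q * W) (p * X', q * W') =
      1 / 2 * (inner X X' + inner W W'
        + (inner (2 *\<^sub>R W - X) (2 *\<^sub>R W' - X') + inner (W - 2 *\<^sub>R X) (W' - 2 *\<^sub>R X')) / 3)"
    unfolding nK_metric_def J i s inner_Pair inner_quat_mult_left n by simp
  also have "\<dots> = 4 / 3 * (inner X X' + inner W W') - 2 / 3 * (inner X W' + inner X' W)"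
    by (simp add: inner_diff_left inner_diff_right inner_commute field_simps)
  finally show ?thesis
    unfolding UV inner_quat_mult_left n using nz by (simp add: mult.assoc [symmetric])
qed

text \<open>The fraction \<open>u / v\<close> is rational, by convention also when \<open>u\<close> or \<open>v\<close> vanishes.\<close>

definition rational_fraction :: "real \<Rightarrow> real \<Rightarrow> bool"
  where "rational_fraction u v \<longleftrightarrow> u = 0 \<or> v = 0 \<or> u / v \<in> \<rat>"

end

theory Submission
  imports Defs
begin

text \<open>The metric \<open>g\<close> is left-invariant, so the Koszul formula turns the geodesic equation for
  \<open>\<gamma>' = (x \<alpha>, y \<beta>)\<close> into the Euler-Arnold equation, here \<open>\<alpha>' = 1/3 [\<alpha>, \<beta>] = - \<beta>'\<close>. Hence
  \<open>\<alpha> + \<beta> = c\<^sub>1\<close> is constant and, with \<open>v = c\<^sub>1/3\<close>, \<open>\<alpha>' = [\<alpha>, v]\<close> and \<open>\<beta>' = [\<beta>, v]\<close>, which is solved by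
  \<open>x(t) = x(0) exp (t u) exp (t v)\<close> and \<open>y(t) = y(0) exp (t u') exp (t v)\<close> where \<open>u = \<alpha>(0) - v\<close> and
  \<open>u' = \<beta>(0) - v\<close>. For the Euclidean metric the same argument gives \<open>\<alpha>' = \<beta>' = 0\<close>, i.e. \<open>\<alpha>(0)\<close> commutes
  with \<open>c\<^sub>1\<close>. A number \<open>T\<close> is a period iff \<open>exp (T u) exp (T v) = 1 = exp (T u') exp (T v)\<close>; when \<open>u, u'\<close>
  are not parallel to \<open>v\<close> this forces \<open>T \<parallel>u\<parallel>, T \<parallel>u'\<parallel>, T \<parallel>v\<parallel>\<close> to be multiples of \<open>\<pi>\<close> of the same parity,
  and \<open>A, B = \<parallel>v\<parallel> \<plusminus> \<parallel>u\<parallel>\<close>, \<open>A', B' = \<parallel>v\<parallel> \<plusminus> \<parallel>u'\<parallel>\<close>.\<close>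

section \<open>Smooth maps\<close>

text \<open>Openness of \<open>S\<close> lets equality on \<open>S\<close> pass to the Frechet
  derivatives at points of \<open>S\<close>, since these depend only on the values near the
  point.\<close>

lemma Ck_on_cong:
  assumes "open S" "\<And>x. x \<in> S \<Longrightarrow> f x = g x" "Ck_on n S f"
  shows "Ck_on n S g"
  using assms(2,3)
proof (induction n arbitrary: f g)
  case 0
  then show ?case using continuous_on_cong[of S S f g] by simp
next
  case (Suc n)
  have D: "(g has_derivative frechet_derivative f (at x)) (at x)" if "x \<in> S" for x
  proof -
    have "(f has_derivative frechet_derivative f (at x)) (at x)"
      using Suc.prems that frechet_derivative_works by auto
    then show ?thesis
      by (rule has_derivative_transform_within_open[OF _ assms(1) that]) (use Suc.prems in auto)
  qed
  have "frechet_derivative g (at x) = frechet_derivative f (at x)" if "x \<in> S" for x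
    using D[OF that] frechet_derivative_at by metis
  then have "Ck_on n S (\<lambda>x. frechet_derivative g (at x) v)" for v
    using Suc.IH[of "\<lambda>x. frechet_derivative f (at x) v"] Suc.prems(2) by simp
  then show ?case using D by (auto simp: differentiable_def)
qed

lemma Ck_on_Suc_imp: "Ck_on (Suc n) S f \<Longrightarrow> Ck_on n S f"
proof (induction n arbitrary: f)
  case 0
  then show ?case
    by (auto intro!: continuous_at_imp_continuous_on differentiable_imp_continuous_within)
qed auto

lemma Ck_on_subset: "Ck_on n S f \<Longrightarrow> T \<subseteq> S \<Longrightarrow> Ck_on n T f"
  by (induction n arbitrary: f) (auto intro: continuous_on_subset)

lemma Ck_on_const: "Ck_on n S (\<lambda>x. c)"
  by (induction n arbitrary: c) (auto simp: frechet_derivative_const)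

lemma Ck_on_id: "Ck_on n S (\<lambda>x. x)"
  by (cases n) (auto simp: frechet_derivative_ident Ck_on_const)

lemma Ck_on_bounded_linear:
  assumes "open S" "bounded_linear h" "Ck_on n S f"
  shows "Ck_on n S (\<lambda>x. h (f x))"
  using assms(3)
proof (induction n arbitrary: f)
  case 0
  then show ?case
    using assms(2) bounded_linear.continuous_on by auto
next
  case (Suc n)
  have D: "((\<lambda>x. h (f x)) has_derivative (\<lambda>v. h (frechet_derivative f (at x) v))) (at x)"
    if "x \<in> S" for x
    using Suc.prems that frechet_derivative_works
    by (auto intro!: bounded_linear.has_derivative[OF assms(2)])
  have "frechet_derivative (\<lambda>x. h (f x)) (at x) = (\<lambda>v. h (frechet_derivative f (at x) v))"
    if "x \<in> S" for x
    using D[OF that] frechet_derivative_at by metis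
  then have "Ck_on n S (\<lambda>x. frechet_derivative (\<lambda>x. h (f x)) (at x) v)" for v
    using Ck_on_cong[OF assms(1), of "\<lambda>x. h (frechet_derivative f (at x) v)"] Suc by simp
  then show ?case using D by (auto simp: differentiable_def)
qed

lemma Ck_on_add:
  assumes "open S" "Ck_on n S f" "Ck_on n S g"
  shows "Ck_on n S (\<lambda>x. f x + g x)"
  using assms(2,3)
proof (induction n arbitrary: f g)
  case 0
  then show ?case by (auto intro: continuous_on_add)
next
  case (Suc n)
  have D: "((\<lambda>x. f x + g x) has_derivative
      (\<lambda>v. frechet_derivative f (at x) v + frechet_derivative g (at x) v)) (at x)"
    if "x \<in> S" for x
    using Suc.prems that frechet_derivative_works by (auto intro!: has_derivative_add)
  have "frechet_derivative (\<lambda>x. f x + g x) (at x) =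
      (\<lambda>v. frechet_derivative f (at x) v + frechet_derivative g (at x) v)"
    if "x \<in> S" for x
    using D[OF that] frechet_derivative_at by metis
  then have "Ck_on n S (\<lambda>x. frechet_derivative (\<lambda>x. f x + g x) (at x) v)" for v
    using Ck_on_cong[OF assms(1),
        of "\<lambda>x. frechet_derivative f (at x) v + frechet_derivative g (at x) v"] Suc by simp
  then show ?case using D by (auto simp: differentiable_def)
qed

text \<open>The Leibniz rule turns the derivative into two products of the same shape. The induction
  varies \<open>f\<close> and \<open>g\<close> because in each product one factor is differentiated,
  while the other merely has its class lowered by \<open>Ck_on_Suc_imp\<close>.\<close>

lemma Ck_on_bounded_bilinear:
  assumes "open S" "bounded_bilinear h" "Ck_on n S f" "Ck_on n S g"
  shows "Ck_on n S (\<lambda>x. h (f x) (g x))"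
  using assms(3,4)
proof (induction n arbitrary: f g)
  case 0
  then show ?case
    using assms(2) bounded_bilinear.continuous_on by auto
next
  case (Suc n)
  let ?D = "\<lambda>x v. h (f x) (frechet_derivative g (at x) v) + h (frechet_derivative f (at x) v) (g x)"
  have D: "((\<lambda>x. h (f x) (g x)) has_derivative ?D x) (at x)" if "x \<in> S" for x
    using Suc.prems that
    by (intro bounded_bilinear.FDERIV[OF assms(2)]) (simp_all flip: frechet_derivative_works)
  have "frechet_derivative (\<lambda>x. h (f x) (g x)) (at x) = ?D x" if "x \<in> S" for x
    using D[OF that] frechet_derivative_at by metis
  moreover have "Ck_on n S (\<lambda>x. ?D x v)" for v
    using Suc.prems by (intro Ck_on_add assms(1) Suc.IH Ck_on_Suc_imp[of n S f] Ck_on_Suc_imp[of n S g])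
      simp_all
  ultimately have "Ck_on n S (\<lambda>x. frechet_derivative (\<lambda>x. h (f x) (g x)) (at x) v)" for v
    using Ck_on_cong[OF assms(1), of "\<lambda>x. ?D x v"] by simp
  then show ?case using D by (auto simp: differentiable_def)
qed

lemma smooth_on_const: "smooth_on S (\<lambda>x. c)"
  by (simp add: smooth_on_def Ck_on_const)

lemma smooth_on_id: "smooth_on S (\<lambda>x. x)"
  by (simp add: smooth_on_def Ck_on_id)

lemma smooth_on_cong:
  "open S \<Longrightarrow> (\<And>x. x \<in> S \<Longrightarrow> f x = g x) \<Longrightarrow> smooth_on S f \<Longrightarrow> smooth_on S g"
  unfolding smooth_on_def using Ck_on_cong by blast

lemma smooth_on_subset: "smooth_on S f \<Longrightarrow> T \<subseteq> S \<Longrightarrow> smooth_on T f"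
  unfolding smooth_on_def using Ck_on_subset by blast

lemma smooth_on_bounded_linear:
  "open S \<Longrightarrow> bounded_linear h \<Longrightarrow> smooth_on S f \<Longrightarrow> smooth_on S (\<lambda>x. h (f x))"
  unfolding smooth_on_def using Ck_on_bounded_linear by blast

lemma smooth_on_add:
  "open S \<Longrightarrow> smooth_on S f \<Longrightarrow> smooth_on S g \<Longrightarrow> smooth_on S (\<lambda>x. f x + g x)"
  unfolding smooth_on_def using Ck_on_add by blast

lemma smooth_on_sum:
  assumes "open S" "\<And>i. i \<in> I \<Longrightarrow> smooth_on S (f i)"
  shows "smooth_on S (\<lambda>x. \<Sum>i\<in>I. f i x)"
  using assms(2)
  by (induction I rule: infinite_finite_induct) (auto simp: smooth_on_const smooth_on_add assms(1))

lemma smooth_on_bounded_bilinear: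
  "open S \<Longrightarrow> bounded_bilinear h \<Longrightarrow> smooth_on S f \<Longrightarrow> smooth_on S g
    \<Longrightarrow> smooth_on S (\<lambda>x. h (f x) (g x))"
  unfolding smooth_on_def using Ck_on_bounded_bilinear by blast

lemmas smooth_on_scaleR = smooth_on_bounded_bilinear[OF _ bounded_bilinear_scaleR]
lemmas smooth_on_inner = smooth_on_bounded_bilinear[OF _ bounded_bilinear_inner]
lemmas smooth_on_fst = smooth_on_bounded_linear[OF _ bounded_linear_fst]
lemmas smooth_on_snd = smooth_on_bounded_linear[OF _ bounded_linear_snd]

lemma smooth_on_diff:
  assumes "open S" "smooth_on S f" "smooth_on S g"
  shows "smooth_on S (\<lambda>x. f x - g x)"
  using smooth_on_add[OF assms(1,2) smooth_on_bounded_linear[OF assms(1) bounded_linear_minus[OF bounded_linear_ident] assms(3)]]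
  by simp

lemma smooth_on_Pair:
  assumes "open S" "smooth_on S f" "smooth_on S g"
  shows "smooth_on S (\<lambda>x. (f x, g x))"
proof -
  have "bounded_linear (\<lambda>z::'b. (z, 0::'c))" "bounded_linear (\<lambda>z::'c. (0::'b, z))"
    by (auto intro!: bounded_linear_Pair bounded_linear_ident bounded_linear_zero)
  then have "smooth_on S (\<lambda>x. (f x, 0) + (0, g x))"
    using assms by (intro smooth_on_add smooth_on_bounded_linear[of S "\<lambda>z. (z, 0)"]
        smooth_on_bounded_linear[of S "\<lambda>z. (0, z)"])
  then show ?thesis by simp
qed

lemma smooth_on_has_derivative:
  assumes "smooth_on S f" "x \<in> S"
  shows "(f has_derivative frechet_derivative f (at x)) (at x)"
proof -
  have "Ck_on (Suc 0) S f" using assms(1) unfolding smooth_on_def by blast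
  then show ?thesis using assms(2) frechet_derivative_works by auto
qed

lemma smooth_on_frechet_derivative:
  assumes "smooth_on S f"
  shows "smooth_on S (\<lambda>x. frechet_derivative f (at x) v)"
  unfolding smooth_on_def
proof
  fix n
  have "Ck_on (Suc n) S f" using assms unfolding smooth_on_def by blast
  then show "Ck_on n S (\<lambda>x. frechet_derivative f (at x) v)" by simp
qed

text \<open>\<open>smooth_on\<close> speaks of derivatives in fixed directions only; expanding the
  moving direction in an orthonormal basis reduces to these. This is what extends
  \<open>eucl_conn X Y\<close> smoothly to a neighbourhood of the product of spheres.\<close>

lemma smooth_on_frechet_derivative_apply:
  fixes f :: "'a::euclidean_space \<Rightarrow> 'b::real_normed_vector"
  assumes "open S" "smooth_on S f" "smooth_on S g"
  shows "smooth_on S (\<lambda>x. frechet_derivative f (at x) (g x))"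
proof (rule smooth_on_cong[OF assms(1)])
  show "smooth_on S (\<lambda>x. \<Sum>i\<in>Basis. (g x \<bullet> i) *\<^sub>R frechet_derivative f (at x) i)"
    by (intro smooth_on_sum smooth_on_scaleR smooth_on_inner smooth_on_frechet_derivative
        smooth_on_const assms)
  show "(\<Sum>i\<in>Basis. (g x \<bullet> i) *\<^sub>R frechet_derivative f (at x) i) = frechet_derivative f (at x) (g x)"
    if "x \<in> S" for x
  proof -
    interpret linear "frechet_derivative f (at x)"
      using smooth_on_has_derivative[OF assms(2) that] has_derivative_linear by blast
    show ?thesis
      by (subst (2) euclidean_representation[of "g x", symmetric]) (simp add: sum scale)
  qed
qed

lemma smooth_on_vector_derivative:
  assumes "smooth_on UNIV f"
  shows "(f has_vector_derivative vector_derivative f (at t)) (at t)"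
    and "vector_derivative f (at t) = frechet_derivative f (at t) 1"
    and "smooth_on UNIV (\<lambda>t. vector_derivative f (at t))"
proof -
  have d: "f differentiable at t" for t
    using smooth_on_has_derivative[OF assms] by (auto simp: differentiable_def)
  show *: "vector_derivative f (at t) = frechet_derivative f (at t) 1" for t
    using frechet_derivative_eq_vector_derivative[OF d] by simp
  show "(f has_vector_derivative vector_derivative f (at t)) (at t)"
    using d vector_derivative_works by blast
  show "smooth_on UNIV (\<lambda>t. vector_derivative f (at t))"
    unfolding * by (rule smooth_on_frechet_derivative[OF assms])
qed

section \<open>Unit quaternions\<close>

lemma ImH_closed [simp, intro]:
  "0 \<in> ImH" "u \<in> ImH \<Longrightarrow> v \<in> ImH \<Longrightarrow> u + v \<in> ImH" "u \<in> ImH \<Longrightarrow> v \<in> ImH \<Longrightarrow> u - v \<in> ImH"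
  "u \<in> ImH \<Longrightarrow> - u \<in> ImH" "u \<in> ImH \<Longrightarrow> r *\<^sub>R u \<in> ImH" "u * v - v * u \<in> ImH"
  by (auto simp: ImH_def)

lemma ImH_square: "u \<in> ImH \<Longrightarrow> u * u = - ((norm u)\<^sup>2 *\<^sub>R 1)"
  unfolding norm_quat_squared by (simp add: ImH_def quat_eq_iff power2_eq_square)

lemma exp_scaleR_derivative_left:
  "((\<lambda>t. exp (t *\<^sub>R u)) has_vector_derivative u * exp (t *\<^sub>R u)) (at t)" for u :: quat
  using exp_scaleR_has_vector_derivative_left[of u t] by simp

lemma vector_derivative_zero_imp_eq:
  fixes f :: "real \<Rightarrow> 'a::real_normed_vector"
  assumes "\<And>t. (f has_vector_derivative 0) (at t)"
  shows "f s = f t"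
  using has_vector_derivative_zero_constant[of UNIV f] assms by (metis UNIV_I convex_UNIV)

text \<open>The curve f(t) = cos (n t) + (sin (n t) / n) u with n = \<open>norm u\<close> solves f'
  = u f and f(0) = 1, so exp (-t u) f(t) is constant. For u = 0 the quotient is harmless because it
  multiplies u.\<close>

lemma exp_ImH:
  assumes "u \<in> ImH"
  shows "exp u = cos (norm u) *\<^sub>R 1 + (sin (norm u) / norm u) *\<^sub>R u"
proof (cases "u = 0")
  case False
  define n where "n = norm u"
  have n: "n > 0" using False by (simp add: n_def)
  have uu: "u * u = - (n\<^sup>2 *\<^sub>R 1)" using ImH_square[OF assms] by (simp add: n_def)
  define f :: "real \<Rightarrow> quat" where "f = (\<lambda>t. cos (n * t) *\<^sub>R 1 + (sin (n * t) / n) *\<^sub>R u)"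
  have f': "(f has_vector_derivative u * f t) (at t)" for t
  proof -
    have "(f has_vector_derivative (- sin (n * t) * n) *\<^sub>R 1 + (cos (n * t) * n / n) *\<^sub>R u) (at t)"
      unfolding f_def by (auto intro!: derivative_eq_intros simp: has_real_derivative_iff_has_vector_derivative[symmetric] n_def[symmetric])
    also have "(- sin (n * t) * n) *\<^sub>R 1 + (cos (n * t) * n / n) *\<^sub>R u = u * f t"
      using n by (simp add: f_def distrib_left uu power2_eq_square)
    finally show ?thesis .
  qed
  have "((\<lambda>t. exp (t *\<^sub>R - u) * f t) has_vector_derivative
      exp (t *\<^sub>R - u) * (u * f t) + (exp (t *\<^sub>R - u) * - u) * f t) (at t)" for t
    by (rule has_vector_derivative_mult[OF exp_scaleR_has_vector_derivative_right f'])
  then have "((\<lambda>t. exp (t *\<^sub>R - u) * f t) has_vector_derivative 0) (at t)" for t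
    by (simp add: mult.assoc)
  from vector_derivative_zero_imp_eq[OF this, of 1 0] have "exp (- u) * f 1 = 1"
    by (simp add: f_def)
  then have "exp u * (exp (- u) * f 1) = exp u" by simp
  then show ?thesis
    by (simp add: mult.assoc[symmetric] exp_minus_inverse f_def n_def)
qed simp

lemma norm_exp_ImH:
  assumes "u \<in> ImH"
  shows "norm (exp u) = 1"
proof -
  have "(norm (exp u))\<^sup>2 = (cos (norm u))\<^sup>2 + (sin (norm u) / norm u)\<^sup>2 * (norm u)\<^sup>2"
    using assms unfolding exp_ImH[OF assms]
    by (simp add: norm_quat_squared ImH_def power_mult_distrib power_divide add_divide_distrib algebra_simps)
  also have "\<dots> = 1" by (cases "u = 0") (simp_all add: power_divide)
  finally show ?thesis by (simp add: power2_eq_1_iff) (use norm_ge_zero[of "exp u"] in linarith)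
qed

section \<open>Directional derivatives and left-invariant fields\<close>

lemma S3xS3_iff: "m \<in> S3xS3 \<longleftrightarrow> norm (fst m) = 1 \<and> norm (snd m) = 1"
  by (cases m) (auto simp: S3xS3_def)

text \<open>The left-invariant vector field on the Lie group \<open>S3xS3\<close> with value
  \<open>\<xi>\<close> at the identity; being linear in \<open>m\<close>, it makes sense on the
  whole ambient space.\<close>

definition linv :: "quat \<times> quat \<Rightarrow> quat \<times> quat \<Rightarrow> quat \<times> quat"
  where "linv \<xi> m = (fst m * fst \<xi>, snd m * snd \<xi>)"

lemma linv_Pair [simp]: "linv (u, v) (p, q) = (p * u, q * v)"
  by (simp add: linv_def)

lemma tangent_eq_linv: "tangent m = (\<lambda>\<xi>. linv \<xi> m) ` (ImH \<times> ImH)"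
  by (cases m) (force simp: tangent_def linv_def)

text \<open>Left multiplication by a unit quaternion is an isometry, so the inner product of
  \<open>p * u\<close> with \<open>p\<close> is the real part of \<open>u\<close>.\<close>

lemma tangent_iff:
  assumes "m \<in> S3xS3"
  shows "z \<in> tangent m \<longleftrightarrow> inner (fst z) (fst m) = 0 \<and> inner (snd z) (snd m) = 0"
proof -
  have *: "(\<exists>u\<in>ImH. w = p * u) \<longleftrightarrow> inner w p = 0" if "norm p = 1" for p w :: quat
  proof -
    have "p \<noteq> 0" using that by auto
    define u where "u = inverse p * w"
    have w: "w = p * u" using \<open>p \<noteq> 0\<close> by (simp add: u_def mult.assoc[symmetric])
    have "inner w p = inner (p * u) (p * 1)" by (simp add: w)
    also have "\<dots> = qRe u" by (simp only: inner_quat_mult_left that) (simp add: inner_quat_def)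
    finally have "inner w p = qRe u" .
    then show ?thesis using w \<open>p \<noteq> 0\<close> by (auto simp: ImH_def)
  qed
  have "z \<in> tangent m \<longleftrightarrow> (\<exists>u\<in>ImH. fst z = fst m * u) \<and> (\<exists>v\<in>ImH. snd z = snd m * v)"
    by (cases m; cases z) (auto simp: tangent_def)
  then show ?thesis using * assms by (simp add: S3xS3_iff)
qed

lemma linear_linv: "linear (\<lambda>\<xi>. linv \<xi> m)"
  by (intro linearI) (auto simp: linv_def distrib_left)

lemma tangent_subspace: "subspace (tangent m)"
proof -
  have "subspace (ImH \<times> ImH)"
    by (auto simp: subspace_def zero_prod_def)
  then show ?thesis unfolding tangent_eq_linv using linear_subspace_image[OF linear_linv] by blast
qed

text \<open>Differentiating along the curve \<open>t \<mapsto> (p exp (t u), q exp (t v))\<close> in \<open>S\<^sup>3 \<times> S\<^sup>3\<close> shows that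
  a derivative within \<open>S\<^sup>3 \<times> S\<^sup>3\<close> is unique on tangent vectors.\<close>

lemma dir_deriv_eqI:
  assumes F: "(f has_derivative F) (at m within S3xS3)" and m: "m \<in> S3xS3" and z: "z \<in> tangent m"
  shows "dir_deriv f m z = F z"
proof -
  obtain p q u v where pq: "m = (p, q)" and uv: "z = (p * u, q * v)" "u \<in> ImH" "v \<in> ImH"
    using z by (cases m) (auto simp: tangent_def)
  define c where "c = (\<lambda>t. (p * exp (t *\<^sub>R u), q * exp (t *\<^sub>R v)))"
  have c0: "c 0 = m" by (simp add: c_def pq)
  have c: "range c \<subseteq> S3xS3"
    using m uv by (auto simp: c_def S3xS3_iff pq norm_mult norm_exp_ImH)
  have "(c has_vector_derivative z) (at 0)"
    unfolding c_def uv
    by (intro has_vector_derivative_Pair has_vector_derivative_mult_right)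
      (use exp_scaleR_has_vector_derivative_right[of u 0 UNIV] exp_scaleR_has_vector_derivative_right[of v 0 UNIV] in simp_all)
  then have c': "(c has_derivative (\<lambda>h. h *\<^sub>R z)) (at 0)"
    by (simp add: has_vector_derivative_def)
  have comp: "((f \<circ> c) has_derivative (\<lambda>h. G (h *\<^sub>R z))) (at 0)"
    if "(f has_derivative G) (at m within S3xS3)" for G
  proof -
    have "(f has_derivative G) (at (c 0) within range c)"
      using has_derivative_subset[OF that c] by (simp add: c0)
    from has_derivative_in_compose[OF c' this] show ?thesis by (simp add: o_def)
  qed
  have "(f has_derivative frechet_derivative f (at m within S3xS3)) (at m within S3xS3)"
    using F frechet_derivative_works differentiable_def by blast
  from has_derivative_unique[OF comp[OF this] comp[OF F]] show ?thesis
    unfolding dir_deriv_def by (metis scaleR_one)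
qed

lemma dir_deriv_constI:
  assumes "\<And>m. m \<in> S3xS3 \<Longrightarrow> f m = k" "m \<in> S3xS3" "z \<in> tangent m"
  shows "dir_deriv f m z = 0"
proof -
  have "((\<lambda>_. k) has_derivative (\<lambda>_. 0)) (at m within S3xS3)" by simp
  then have "(f has_derivative (\<lambda>_. 0)) (at m within S3xS3)"
    by (rule has_derivative_transform[OF assms(2) assms(1), rotated 1])
  from dir_deriv_eqI[OF this assms(2,3)] show ?thesis .
qed

lemma bounded_linear_linv: "bounded_linear (linv \<xi>)"
  unfolding linv_def
  by (intro bounded_linear_Pair bounded_linear_mult_const bounded_linear_fst bounded_linear_snd)

lemma smooth_fun_I: "smooth_on UNIV f \<Longrightarrow> smooth_fun f"
  unfolding smooth_fun_def by blast

lemma linv_vector_field: "\<xi> \<in> ImH \<times> ImH \<Longrightarrow> linv \<xi> \<in> vector_fields"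
  unfolding vector_fields_def tangent_eq_linv
  by (auto intro!: smooth_fun_I smooth_on_bounded_linear[OF open_UNIV bounded_linear_linv smooth_on_id])

definition brk :: "quat \<times> quat \<Rightarrow> quat \<times> quat \<Rightarrow> quat \<times> quat"
  where "brk \<xi> \<eta> = (fst \<xi> * fst \<eta> - fst \<eta> * fst \<xi>, snd \<xi> * snd \<eta> - snd \<eta> * snd \<xi>)"

text \<open>A left-invariant field is linear in the base point and hence its own derivative.
  Differentiating \<open>linv \<eta>\<close> along \<open>linv \<xi>\<close> multiplies from the
  right by \<xi> and then by \<eta>; antisymmetrising leaves the commutator.\<close>

lemma lie_bracket_linv:
  assumes "m \<in> S3xS3" "\<xi> \<in> ImH \<times> ImH" "\<eta> \<in> ImH \<times> ImH"
  shows "lie_bracket (linv \<xi>) (linv \<eta>) m = linv (brk \<xi> \<eta>) m"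
proof -
  have "dir_deriv (linv \<eta>) m (linv \<xi> m) = linv \<eta> (linv \<xi> m)" if "\<xi> \<in> ImH \<times> ImH" for \<xi> \<eta>
    using that assms(1) bounded_linear_imp_has_derivative[OF bounded_linear_linv]
    by (intro dir_deriv_eqI) (auto simp: tangent_eq_linv)
  then show ?thesis
    using assms unfolding lie_bracket_def
    by (simp add: linv_def brk_def mult.assoc right_diff_distrib)
qed

lemma linv_sum_scaleR: "linv (\<Sum>i\<in>I. f i *\<^sub>R b i) m = (\<Sum>i\<in>I. f i *\<^sub>R linv (b i) m)"
  using linear_sum[OF linear_linv, of "\<lambda>i. f i *\<^sub>R b i" I m] by (simp add: linear_cmul[OF linear_linv])

lemma linv_eq_0_iff:
  assumes "m \<in> S3xS3"
  shows "linv \<xi> m = 0 \<longleftrightarrow> \<xi> = 0"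
  using assms by (cases \<xi>; cases m) (auto simp: S3xS3_iff zero_prod_def)

lemma linv_diff: "linv (\<xi> - \<eta>) m = linv \<xi> m - linv \<eta> m"
  by (simp add: linv_def right_diff_distrib)

lemma linv_inj: "m \<in> S3xS3 \<Longrightarrow> linv \<xi> m = linv \<eta> m \<longleftrightarrow> \<xi> = \<eta>"
  using linv_eq_0_iff[of m "\<xi> - \<eta>"] by (simp add: linv_diff)

lemma vector_fields_sum:
  assumes "\<And>i. i \<in> I \<Longrightarrow> b i \<in> ImH \<times> ImH"
  shows "(\<lambda>m. \<Sum>i\<in>I. f i *\<^sub>R linv (b i) m) \<in> vector_fields"
proof -
  have "(\<Sum>i\<in>I. f i *\<^sub>R b i) \<in> ImH \<times> ImH"
    using assms
    by (induction I rule: infinite_finite_induct) (auto simp: mem_Times_iff)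
  from linv_vector_field[OF this] show ?thesis
    by (simp add: linv_sum_scaleR[abs_def])
qed

section \<open>The Euler-Arnold equation\<close>

lemma affine_connection_closed:
  assumes "affine_connection N" "X \<in> vector_fields" "Y \<in> vector_fields"
  shows "N X Y \<in> vector_fields"
proof -
  have "\<forall>X\<in>vector_fields. \<forall>Y\<in>vector_fields. N X Y \<in> vector_fields"
    using assms(1) unfolding affine_connection_def by (elim conjE)
  with assms(2-) show ?thesis by blast
qed

lemma affine_connection_add:
  assumes "affine_connection N" "X \<in> vector_fields" "Y \<in> vector_fields" "Y' \<in> vector_fields" "m \<in> S3xS3"
  shows "N X (\<lambda>p. Y p + Y' p) m = N X Y m + N X Y' m"
proof -
  have "\<forall>X\<in>vector_fields. \<forall>Y\<in>vector_fields. \<forall>Y'\<in>vector_fields. \<forall>p\<in>S3xS3.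
       N X (\<lambda>p. Y p + Y' p) p = N X Y p + N X Y' p"
    using assms(1) unfolding affine_connection_def by (elim conjE)
  from this[rule_format, OF assms(2-)] show ?thesis .
qed

lemma affine_connection_scaleR:
  assumes "affine_connection N" "smooth_fun f" "X \<in> vector_fields" "Y \<in> vector_fields" "m \<in> S3xS3"
  shows "N X (\<lambda>p. f p *\<^sub>R Y p) m = dir_deriv f m (X m) *\<^sub>R Y m + f m *\<^sub>R N X Y m"
proof -
  have "\<forall>f. smooth_fun f \<longrightarrow> (\<forall>X\<in>vector_fields. \<forall>Y\<in>vector_fields. \<forall>p\<in>S3xS3.
       N X (\<lambda>p. f p *\<^sub>R Y p) p = dir_deriv f p (X p) *\<^sub>R Y p + f p *\<^sub>R N X Y p)"
    using assms(1) unfolding affine_connection_def by (elim conjE)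
  from this[rule_format, OF assms(2-)] show ?thesis .
qed

lemma covariant_derivative_along_add:
  assumes "covariant_derivative_along N \<gamma> D" "V \<in> fields_along \<gamma>" "W \<in> fields_along \<gamma>"
  shows "D (\<lambda>t. V t + W t) t = D V t + D W t"
proof -
  have "\<forall>V\<in>fields_along \<gamma>. \<forall>W\<in>fields_along \<gamma>. \<forall>t. D (\<lambda>t. V t + W t) t = D V t + D W t"
    using assms(1) unfolding covariant_derivative_along_def by (elim conjE)
  from this[rule_format, OF assms(2-)] show ?thesis .
qed

lemma covariant_derivative_along_scaleR:
  assumes "covariant_derivative_along N \<gamma> D" "smooth_on UNIV f" "V \<in> fields_along \<gamma>"
  shows "D (\<lambda>t. f t *\<^sub>R V t) t = deriv f t *\<^sub>R V t + f t *\<^sub>R D V t"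
proof -
  have "\<forall>f. smooth_on UNIV f \<longrightarrow> (\<forall>V\<in>fields_along \<gamma>. \<forall>t.
       D (\<lambda>t. f t *\<^sub>R V t) t = deriv f t *\<^sub>R V t + f t *\<^sub>R D V t)"
    using assms(1) unfolding covariant_derivative_along_def by (elim conjE)
  from this[rule_format, OF assms(2-)] show ?thesis .
qed

lemma covariant_derivative_along_induced:
  assumes "covariant_derivative_along N \<gamma> D" "X \<in> vector_fields" "Y \<in> vector_fields"
    "X (\<gamma> t) = velocity \<gamma> t"
  shows "D (\<lambda>t. Y (\<gamma> t)) t = N X Y (\<gamma> t)"
proof -
  have "\<forall>X\<in>vector_fields. \<forall>Y\<in>vector_fields. \<forall>t. X (\<gamma> t) = velocity \<gamma> t \<longrightarrow>
       D (\<lambda>t. Y (\<gamma> t)) t = N X Y (\<gamma> t)"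
    using assms(1) unfolding covariant_derivative_along_def by (elim conjE)
  from this[rule_format, OF assms(2-)] show ?thesis .
qed

lemma levi_civita_torsion_free:
  assumes "levi_civita g N" "X \<in> vector_fields" "Y \<in> vector_fields" "m \<in> S3xS3"
  shows "N X Y m - N Y X m = lie_bracket X Y m"
proof -
  have "\<forall>X\<in>vector_fields. \<forall>Y\<in>vector_fields. \<forall>p\<in>S3xS3. N X Y p - N Y X p = lie_bracket X Y p"
    using assms(1) unfolding levi_civita_def by (elim conjE)
  with assms(2-) show ?thesis by blast
qed

lemma levi_civita_metric:
  assumes "levi_civita g N" "X \<in> vector_fields" "Y \<in> vector_fields" "Z \<in> vector_fields" "m \<in> S3xS3"
  shows "dir_deriv (\<lambda>p. g p (Y p) (Z p)) m (X m) = g m (N X Y m) (Z m) + g m (Y m) (N X Z m)"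
proof -
  have "\<forall>X\<in>vector_fields. \<forall>Y\<in>vector_fields. \<forall>Z\<in>vector_fields. \<forall>p\<in>S3xS3.
       dir_deriv (\<lambda>p. g p (Y p) (Z p)) p (X p) = g p (N X Y p) (Z p) + g p (Y p) (N X Z p)"
    using assms(1) unfolding levi_civita_def by (elim conjE)
  from this[rule_format, OF assms(2-)] show ?thesis .
qed

text \<open>The coefficients are constants, so the derivative term of the Leibniz rule vanishes and
  only linearity remains.\<close>

lemma affine_connection_sum:
  assumes N: "affine_connection N" and X: "X \<in> vector_fields" and m: "m \<in> S3xS3"
    and b: "\<And>i. i \<in> I \<Longrightarrow> b i \<in> ImH \<times> ImH"
  shows "N X (\<lambda>m. \<Sum>i\<in>I. f i *\<^sub>R linv (b i) m) m = (\<Sum>i\<in>I. f i *\<^sub>R N X (linv (b i)) m)"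
proof -
  have Xm: "X m \<in> tangent m" using X m by (auto simp: vector_fields_def)
  have scale: "N X (\<lambda>p. k *\<^sub>R Y p) m = k *\<^sub>R N X Y m" if "Y \<in> vector_fields" for k Y
  proof -
    have "smooth_fun (\<lambda>_. k)" by (intro smooth_fun_I smooth_on_const)
    then have "N X (\<lambda>p. k *\<^sub>R Y p) m = dir_deriv (\<lambda>_. k) m (X m) *\<^sub>R Y m + k *\<^sub>R N X Y m"
      using affine_connection_scaleR[OF N _ X that m] by simp
    also have "dir_deriv (\<lambda>_. k) m (X m) = 0" by (rule dir_deriv_constI[OF refl m Xm])
    finally show ?thesis by simp
  qed
  have z: "linv 0 = (\<lambda>_. 0)" by (simp add: linv_def zero_prod_def fun_eq_iff)
  have "N X (\<lambda>_. 0) m = 0"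
    using scale[OF linv_vector_field, of 0 0] by (simp add: z mem_Times_iff)
  then show ?thesis using b
  proof (induction I rule: infinite_finite_induct)
    case (insert i I)
    have v: "linv (f i *\<^sub>R b i) \<in> vector_fields"
      using insert.prems by (intro linv_vector_field) (auto simp: mem_Times_iff)
    have e: "linv (f i *\<^sub>R b i) = (\<lambda>p. f i *\<^sub>R linv (b i) p)"
      by (simp add: linv_def fun_eq_iff)
    have "N X (\<lambda>p. f i *\<^sub>R linv (b i) p + (\<Sum>i\<in>I. f i *\<^sub>R linv (b i) p)) m
        = N X (\<lambda>p. f i *\<^sub>R linv (b i) p) m + N X (\<lambda>p. \<Sum>i\<in>I. f i *\<^sub>R linv (b i) p) m"
      using insert.prems
      by (intro affine_connection_add[OF N X _ _ m] v[unfolded e] vector_fields_sum) auto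
    also have "\<dots> = f i *\<^sub>R N X (linv (b i)) m + (\<Sum>i\<in>I. f i *\<^sub>R N X (linv (b i)) m)"
      using insert linv_vector_field scale by simp
    finally show ?case using insert.hyps by simp
  qed simp_all
qed

lemma smooth_fields_along_linv:
  assumes "smooth_curve \<gamma>" "\<xi> \<in> ImH \<times> ImH"
  shows "(\<lambda>t. linv \<xi> (\<gamma> t)) \<in> fields_along \<gamma>"
  using assms
  by (auto simp: fields_along_def smooth_curve_def tangent_eq_linv
      intro!: smooth_on_bounded_linear[OF open_UNIV bounded_linear_linv])

lemma fields_along_scaleR:
  assumes "smooth_on UNIV f" "V \<in> fields_along \<gamma>"
  shows "(\<lambda>t. f t *\<^sub>R V t) \<in> fields_along \<gamma>"
  using assms
  by (auto simp: fields_along_def intro!: smooth_on_scaleR subspace_scale[OF tangent_subspace])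

lemma fields_along_sum:
  assumes "\<And>i. i \<in> I \<Longrightarrow> V i \<in> fields_along \<gamma>"
  shows "(\<lambda>t. \<Sum>i\<in>I. V i t) \<in> fields_along \<gamma>"
  using assms
  by (auto simp: fields_along_def intro!: smooth_on_sum subspace_sum[OF tangent_subspace])

lemma covariant_derivative_along_sum:
  assumes D: "covariant_derivative_along N \<gamma> D"
    and V: "\<And>i. i \<in> I \<Longrightarrow> V i \<in> fields_along \<gamma>"
  shows "D (\<lambda>t. \<Sum>i\<in>I. V i t) t = (\<Sum>i\<in>I. D (V i) t)"
proof -
  \<comment> \<open>The empty sum needs \<open>D\<close> to kill the zero field, which is the
    Leibniz rule with coefficient 0.\<close>
  have "(\<lambda>_. 0) \<in> fields_along \<gamma>" using fields_along_sum[of "{}"] by simp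
  moreover have "smooth_on UNIV (\<lambda>_::real. 0::real)" by (rule smooth_on_const)
  ultimately have "D (\<lambda>t. 0 *\<^sub>R 0) t = deriv (\<lambda>_. 0) t *\<^sub>R 0 + 0 *\<^sub>R D (\<lambda>_. 0) t"
    using covariant_derivative_along_scaleR[OF D] by blast
  then have "D (\<lambda>_. 0) t = 0" by simp
  then show ?thesis using V
  proof (induction I rule: infinite_finite_induct)
    case (insert i I)
    have "D (\<lambda>t. V i t + (\<Sum>i\<in>I. V i t)) t = D (V i) t + D (\<lambda>t. \<Sum>i\<in>I. V i t) t"
      using insert.prems
      by (intro covariant_derivative_along_add[OF D] fields_along_sum) auto
    then show ?case using insert by simp
  qed simp_all
qed

text \<open>The six imaginary coordinate vectors; the fields \<open>linv b\<close> form a global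
  left-invariant frame in which velocities are expanded.\<close>

definition ImB :: "(quat \<times> quat) set"
  where "ImB = Basis \<inter> ImH \<times> ImH"

lemma ImB_representation:
  assumes "\<xi> \<in> ImH \<times> ImH"
  shows "(\<Sum>b\<in>ImB. inner \<xi> b *\<^sub>R b) = \<xi>"
proof -
  have "(\<Sum>b\<in>ImB. inner \<xi> b *\<^sub>R b) = (\<Sum>b\<in>Basis. inner \<xi> b *\<^sub>R b)"
  proof (rule sum.mono_neutral_left)
    show "\<forall>b\<in>Basis - ImB. inner \<xi> b *\<^sub>R b = 0"
      using assms
      by (auto simp: ImB_def Basis_prod_def Basis_quat_def ImH_def inner_quat_def zero_prod_def)
  qed (auto simp: ImB_def)
  then show ?thesis by (simp add: euclidean_representation)
qed

lemma inner_linv: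
  assumes "m \<in> S3xS3"
  shows "inner (linv \<xi> m) (linv \<eta> m) = inner \<xi> \<eta>"
  using assms by (simp add: linv_def inner_prod_def inner_quat_mult_left S3xS3_iff)

text \<open>No regularity of \<open>\<xi>\<close> is assumed: its coordinates are recovered by
  pairing the smooth velocity with left-invariant fields, left translations being Euclidean
  isometries.\<close>

lemma smooth_curve_angular_velocity:
  assumes \<gamma>: "smooth_curve \<gamma>"
    and vel: "\<And>t. velocity \<gamma> t = linv (\<xi> t) (\<gamma> t)" "\<And>t. \<xi> t \<in> ImH \<times> ImH"
  shows "smooth_on UNIV (\<lambda>t. inner (\<xi> t) b)"
proof (rule smooth_on_cong[OF open_UNIV])
  have "smooth_on UNIV \<gamma>" using \<gamma> by (simp add: smooth_curve_def)
  then show "smooth_on UNIV (\<lambda>t. inner (velocity \<gamma> t) (linv b (\<gamma> t)))"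
    unfolding velocity_def
    by (intro smooth_on_inner smooth_on_vector_derivative open_UNIV
        smooth_on_bounded_linear[OF _ bounded_linear_linv])
  show "inner (velocity \<gamma> t) (linv b (\<gamma> t)) = inner (\<xi> t) b" for t
    unfolding vel by (rule inner_linv) (use \<gamma> in \<open>auto simp: smooth_curve_def\<close>)
qed

text \<open>For left-invariant \<open>X\<close>, \<open>Z\<close> the functions \<open>g(X, X)\<close> and \<open>g(X, Z)\<close> are constant, which gives
  \<open>g(N\<^sub>X X, Z) = - g(X, N\<^sub>X Z) = - g(X, [X, Z]) - g(X, N\<^sub>Z X) = - g(X, [X, Z])\<close>.\<close>

lemma levi_civita_linv:
  assumes N: "levi_civita g N" and m: "m \<in> S3xS3"
    and g: "\<And>m \<xi> \<eta>. m \<in> S3xS3 \<Longrightarrow> \<xi> \<in> ImH \<times> ImH \<Longrightarrow> \<eta> \<in> ImH \<times> ImH \<Longrightarrow>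
      g m (linv \<xi> m) (linv \<eta> m) = Q \<xi> \<eta>"
    and Q: "bilinear Q" "\<And>\<xi> \<eta>. Q \<xi> \<eta> = Q \<eta> \<xi>"
    and \<xi>: "\<xi> \<in> ImH \<times> ImH" and \<zeta>: "\<zeta> \<in> ImH \<times> ImH"
  shows "g m (N (linv \<xi>) (linv \<xi>) m) (linv \<zeta> m) = - Q \<xi> (brk \<xi> \<zeta>)"
proof -
  note vf = linv_vector_field[OF \<xi>] linv_vector_field[OF \<zeta>]
  have "affine_connection N" using N by (simp add: levi_civita_def)
  note closed = affine_connection_closed[OF this]
  have tan: "N X Y m \<in> tangent m" if "X \<in> vector_fields" "Y \<in> vector_fields" for X Y
    using closed[OF that] m by (simp add: vector_fields_def)
  have "\<exists>\<eta>\<in>ImH \<times> ImH. N X Y m = linv \<eta> m" if "X \<in> vector_fields" "Y \<in> vector_fields" for X Y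
    using tan[OF that] unfolding tangent_eq_linv by blast
  then obtain \<eta> \<sigma> \<tau> where
    \<eta>: "\<eta> \<in> ImH \<times> ImH" "N (linv \<xi>) (linv \<xi>) m = linv \<eta> m" and
    \<sigma>: "\<sigma> \<in> ImH \<times> ImH" "N (linv \<xi>) (linv \<zeta>) m = linv \<sigma> m" and
    \<tau>: "\<tau> \<in> ImH \<times> ImH" "N (linv \<zeta>) (linv \<xi>) m = linv \<tau> m"
    using vf by metis
  note compat = levi_civita_metric[OF N _ _ _ m]
  have const: "dir_deriv (\<lambda>p. g p (linv \<rho> p) (linv \<rho>' p)) m (linv \<theta> m) = 0"
    if "\<rho> \<in> ImH \<times> ImH" "\<rho>' \<in> ImH \<times> ImH" "\<theta> \<in> ImH \<times> ImH" for \<rho> \<rho>' \<theta>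
    by (rule dir_deriv_constI[of _ "Q \<rho> \<rho>'"]) (use that m g in \<open>auto simp: tangent_eq_linv\<close>)
  have 1: "Q \<eta> \<zeta> + Q \<xi> \<sigma> = 0"
    using compat[OF vf(1) vf(1) vf(2)] const[OF \<xi> \<zeta> \<xi>] m \<eta> \<sigma> \<xi> \<zeta> by (simp add: g)
  have 2: "Q \<tau> \<xi> + Q \<xi> \<tau> = 0"
    using compat[OF vf(2) vf(1) vf(1)] const[OF \<xi> \<xi> \<zeta>] m \<tau> \<xi> \<zeta> by (simp add: g)
  have "linv \<sigma> m - linv \<tau> m = linv (brk \<xi> \<zeta>) m"
    using levi_civita_torsion_free[OF N vf m] lie_bracket_linv[OF m \<xi> \<zeta>] \<sigma> \<tau> by simp
  then have "\<sigma> - \<tau> = brk \<xi> \<zeta>" using linv_inj[OF m] by (simp add: linv_diff[symmetric])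
  then have "Q \<xi> (brk \<xi> \<zeta>) = Q \<xi> \<sigma> - Q \<xi> \<tau>" using bilinear_rsub[OF Q(1)] by metis
  then show ?thesis using 1 2 Q(2)[of \<tau> \<xi>] g[OF m \<eta>(1) \<zeta>] \<eta>(2) by simp
qed

text \<open>In the left-invariant frame the covariant derivative of the velocity splits into the
  field of \<open>\<xi>'\<close> plus the derivative along itself of the field frozen at time
  \<open>t\<close>. That the sum vanishes, tested by \<open>levi_civita_linv\<close>, is the
  Euler-Arnold equation.\<close>

lemma geodesic_euler_arnold:
  assumes geo: "geodesic g \<gamma>"
    and vel: "\<And>t. velocity \<gamma> t = linv (\<xi> t) (\<gamma> t)" "\<And>t. \<xi> t \<in> ImH \<times> ImH"
    and g: "\<And>m \<xi> \<eta>. m \<in> S3xS3 \<Longrightarrow> \<xi> \<in> ImH \<times> ImH \<Longrightarrow> \<eta> \<in> ImH \<times> ImH \<Longrightarrow>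
      g m (linv \<xi> m) (linv \<eta> m) = Q \<xi> \<eta>"
    and Q: "bilinear Q" "\<And>\<xi> \<eta>. Q \<xi> \<eta> = Q \<eta> \<xi>"
  obtains \<xi>' where "(\<xi> has_vector_derivative \<xi>') (at t)" "\<xi>' \<in> ImH \<times> ImH"
    "\<And>\<zeta>. \<zeta> \<in> ImH \<times> ImH \<Longrightarrow> Q \<xi>' \<zeta> = Q (\<xi> t) (brk (\<xi> t) \<zeta>)"
proof -
  obtain N D where LC: "levi_civita g N" and D: "covariant_derivative_along N \<gamma> D"
    and D0: "\<And>t. D (velocity \<gamma>) t = 0" and \<gamma>: "smooth_curve \<gamma>"
    using geo unfolding geodesic_def by blast
  have N: "affine_connection N" using LC by (simp add: levi_civita_def)
  define m where "m = \<gamma> t"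
  have m: "m \<in> S3xS3" using \<gamma> by (auto simp: smooth_curve_def m_def)
  define f where "f = (\<lambda>b t. inner (\<xi> t) b)"
  have sf: "smooth_on UNIV (f b)" for b
    unfolding f_def by (rule smooth_curve_angular_velocity[OF \<gamma> vel])
  define \<xi>' where "\<xi>' = (\<Sum>b\<in>ImB. deriv (f b) t *\<^sub>R b)"
  have df: "(f b has_vector_derivative deriv (f b) t) (at t)" for b
  proof -
    have "f b differentiable at t"
      using smooth_on_has_derivative[OF sf UNIV_I] unfolding differentiable_def by blast
    then show ?thesis
      using DERIV_deriv_iff_real_differentiable has_real_derivative_iff_has_vector_derivative by blast
  qed
  have rep: "\<xi> = (\<lambda>t. \<Sum>b\<in>ImB. f b t *\<^sub>R b)"
    using ImB_representation[OF vel(2)] by (simp add: f_def)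
  have Im: "b \<in> ImH \<times> ImH" if "b \<in> ImB" for b using that by (simp add: ImB_def)
  have d: "(\<xi> has_vector_derivative \<xi>') (at t)"
    unfolding \<xi>'_def by (subst rep) (intro has_vector_derivative_sum
      bounded_linear.has_vector_derivative[OF bounded_linear_scaleR_left df])
  have \<xi>': "\<xi>' \<in> ImH \<times> ImH"
    unfolding \<xi>'_def using Im
    by (intro subspace_sum) (auto simp: subspace_def zero_prod_def mem_Times_iff)
  have X: "linv (\<xi> t) \<in> vector_fields" by (rule linv_vector_field[OF vel(2)])
  note E = smooth_fields_along_linv[OF \<gamma> Im]
  have DE: "D (\<lambda>s. f b s *\<^sub>R linv b (\<gamma> s)) t =
      deriv (f b) t *\<^sub>R linv b m + f b t *\<^sub>R N (linv (\<xi> t)) (linv b) m" if "b \<in> ImB" for b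
  proof -
    have "D (\<lambda>s. f b s *\<^sub>R linv b (\<gamma> s)) t =
        deriv (f b) t *\<^sub>R linv b (\<gamma> t) + f b t *\<^sub>R D (\<lambda>s. linv b (\<gamma> s)) t"
      by (rule covariant_derivative_along_scaleR[OF D sf E[OF that]])
    also have "D (\<lambda>s. linv b (\<gamma> s)) t = N (linv (\<xi> t)) (linv b) (\<gamma> t)"
      using covariant_derivative_along_induced[OF D X linv_vector_field[OF Im[OF that]]] vel(1) by simp
    finally show ?thesis by (simp add: m_def)
  qed
  have "velocity \<gamma> = (\<lambda>s. \<Sum>b\<in>ImB. f b s *\<^sub>R linv b (\<gamma> s))"
    using vel(1) by (subst (asm) rep) (simp add: linv_sum_scaleR fun_eq_iff)
  then have "D (velocity \<gamma>) t = (\<Sum>b\<in>ImB. D (\<lambda>s. f b s *\<^sub>R linv b (\<gamma> s)) t)"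
    using covariant_derivative_along_sum[OF D, of ImB "\<lambda>b s. f b s *\<^sub>R linv b (\<gamma> s)" t]
      fields_along_scaleR[OF sf E] by simp
  also have "\<dots> = (\<Sum>b\<in>ImB. deriv (f b) t *\<^sub>R linv b m)
      + (\<Sum>b\<in>ImB. f b t *\<^sub>R N (linv (\<xi> t)) (linv b) m)"
    by (simp add: DE sum.distrib)
  also have "(\<Sum>b\<in>ImB. f b t *\<^sub>R N (linv (\<xi> t)) (linv b) m) =
      N (linv (\<xi> t)) (\<lambda>p. \<Sum>b\<in>ImB. f b t *\<^sub>R linv b p) m"
    using affine_connection_sum[OF N X m, of ImB "\<lambda>b. b"] Im by simp
  also have "(\<lambda>p. \<Sum>b\<in>ImB. f b t *\<^sub>R linv b p) = linv (\<xi> t)"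
    by (subst rep) (simp add: linv_sum_scaleR fun_eq_iff)
  finally have eq: "N (linv (\<xi> t)) (linv (\<xi> t)) m = - linv \<xi>' m"
    using D0[of t] by (simp add: \<xi>'_def linv_sum_scaleR eq_neg_iff_add_eq_0 add.commute)
  also have "\<dots> = linv (- \<xi>') m" by (simp add: linv_def)
  finally have eq: "N (linv (\<xi> t)) (linv (\<xi> t)) m = linv (- \<xi>') m" .
  show thesis
  proof (rule that[OF d \<xi>'])
    fix \<zeta> assume \<zeta>: "\<zeta> \<in> ImH \<times> ImH"
    have "Q (- \<xi>') \<zeta> = - Q (\<xi> t) (brk (\<xi> t) \<zeta>)"
      using levi_civita_linv[OF LC m g Q vel(2)[of t] \<zeta>] g[OF m _ \<zeta>, of "- \<xi>'"] \<xi>'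
      by (simp add: eq mem_Times_iff)
    then show "Q \<xi>' \<zeta> = Q (\<xi> t) (brk (\<xi> t) \<zeta>)"
      using bilinear_lneg[OF Q(1)] by simp
  qed
qed

section \<open>The Levi-Civita connection of the Euclidean product metric\<close>

text \<open>For \<open>m\<close> in \<open>S3xS3\<close> this is the orthogonal projection onto
  \<open>tangent m\<close>; the polynomial formula is smooth in both arguments on the whole ambient
  space.\<close>

definition tanproj :: "quat \<times> quat \<Rightarrow> quat \<times> quat \<Rightarrow> quat \<times> quat"
  where "tanproj m z = (fst z - inner (fst z) (fst m) *\<^sub>R fst m, snd z - inner (snd z) (snd m) *\<^sub>R snd m)"

lemma tanproj_add: "tanproj m (z + w) = tanproj m z + tanproj m w"
  by (simp add: tanproj_def inner_add_left scaleR_add_left)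

lemma tanproj_diff: "tanproj m (z - w) = tanproj m z - tanproj m w"
  by (simp add: tanproj_def inner_diff_left scaleR_diff_left)

lemma tanproj_scaleR: "tanproj m (r *\<^sub>R z) = r *\<^sub>R tanproj m z"
  by (simp add: tanproj_def scaleR_diff_right)

lemma tanproj_in_tangent: "m \<in> S3xS3 \<Longrightarrow> tanproj m z \<in> tangent m"
  by (simp add: tangent_iff tanproj_def inner_diff_left S3xS3_iff dot_square_norm)

lemma tanproj_tangent: "m \<in> S3xS3 \<Longrightarrow> z \<in> tangent m \<Longrightarrow> tanproj m z = z"
  by (cases z) (simp add: tangent_iff tanproj_def)

lemma inner_tanproj: "m \<in> S3xS3 \<Longrightarrow> w \<in> tangent m \<Longrightarrow> inner (tanproj m z) w = inner z w"
  by (auto simp: tangent_iff tanproj_def inner_prod_def inner_diff_left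
      inner_commute[of "fst m"] inner_commute[of "snd m"])

lemma smooth_on_tanproj:
  assumes "open S" "smooth_on S f" "smooth_on S h"
  shows "smooth_on S (\<lambda>x. tanproj (f x) (h x))"
  unfolding tanproj_def
  by (intro smooth_on_Pair smooth_on_diff smooth_on_scaleR smooth_on_inner smooth_on_fst smooth_on_snd assms)

text \<open>The derivative behind \<open>dir_deriv\<close> is pinned down only on tangent vectors.
  The \<open>F\<close> of a smooth extension can be fed into the rules for sums and products, and
  the result compared with \<open>dir_deriv\<close> on tangent vectors again.\<close>

lemma smooth_fun_derivative:
  assumes "smooth_fun f" "m \<in> S3xS3"
  obtains F where "(f has_derivative F) (at m within S3xS3)"
    "\<And>z. z \<in> tangent m \<Longrightarrow> dir_deriv f m z = F z"
proof -
  obtain U G where U: "S3xS3 \<subseteq> U" "smooth_on U G" "\<And>p. p \<in> S3xS3 \<Longrightarrow> G p = f p"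
    using assms(1) unfolding smooth_fun_def by blast
  have "(G has_derivative frechet_derivative G (at m)) (at m within S3xS3)"
    using smooth_on_has_derivative[OF U(2)] U(1) assms(2) by (blast intro: has_derivative_at_withinI)
  then have "(f has_derivative frechet_derivative G (at m)) (at m within S3xS3)"
    by (rule has_derivative_transform[OF assms(2), rotated]) (simp add: U(3))
  then show thesis using that dir_deriv_eqI[OF _ assms(2)] by blast
qed

lemma vector_fieldD:
  assumes "X \<in> vector_fields"
  shows "smooth_fun X" "m \<in> S3xS3 \<Longrightarrow> X m \<in> tangent m"
  using assms by (auto simp: vector_fields_def)

text \<open>The Gauss formula: the tangential part of the ambient derivative. An explicit connection
  is needed because \<open>geodesic\<close> asserts that one exists, and the converse direction of
  claim (1) has to produce it. For \<open>nK_metric\<close> the connection comes with the assumed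
  geodesic.\<close>

definition eucl_conn :: connection
  where "eucl_conn X Y m = tanproj m (dir_deriv Y m (X m))"

lemma eucl_conn_vector_field:
  assumes X: "X \<in> vector_fields" and Y: "Y \<in> vector_fields"
  shows "eucl_conn X Y \<in> vector_fields"
proof -
  obtain U F where F: "open U" "S3xS3 \<subseteq> U" "smooth_on U F" "\<And>p. p \<in> S3xS3 \<Longrightarrow> F p = Y p"
    using vector_fieldD(1)[OF Y] unfolding smooth_fun_def by blast
  obtain W G where G: "open W" "S3xS3 \<subseteq> W" "smooth_on W G" "\<And>p. p \<in> S3xS3 \<Longrightarrow> G p = X p"
    using vector_fieldD(1)[OF X] unfolding smooth_fun_def by blast
  have UW: "open (U \<inter> W)" using F G by blast
  \<comment> \<open>The extension combines an extension \<open>F\<close> of \<open>Y\<close> with an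
    extension \<open>G\<close> of \<open>X\<close> on their common neighbourhood.\<close>
  have "smooth_on (U \<inter> W) (\<lambda>m. tanproj m (frechet_derivative F (at m) (G m)))"
    using smooth_on_subset[OF F(3), of "U \<inter> W"] smooth_on_subset[OF G(3), of "U \<inter> W"]
    by (intro smooth_on_tanproj smooth_on_frechet_derivative_apply UW smooth_on_id) auto
  moreover have "tanproj m (frechet_derivative F (at m) (G m)) = eucl_conn X Y m" if m: "m \<in> S3xS3" for m
  proof -
    have "(F has_derivative frechet_derivative F (at m)) (at m within S3xS3)"
      using smooth_on_has_derivative[OF F(3)] F(2) m by (blast intro: has_derivative_at_withinI)
    then have "(Y has_derivative frechet_derivative F (at m)) (at m within S3xS3)"
      by (rule has_derivative_transform[OF m, rotated]) (simp add: F(4))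
    from dir_deriv_eqI[OF this m vector_fieldD(2)[OF X m]] show ?thesis
      by (simp add: eucl_conn_def G(4)[OF m])
  qed
  ultimately have "smooth_fun (eucl_conn X Y)"
    unfolding smooth_fun_def using UW F(2) G(2) by blast
  moreover have "eucl_conn X Y m \<in> tangent m" if "m \<in> S3xS3" for m
    unfolding eucl_conn_def by (rule tanproj_in_tangent[OF that])
  ultimately show ?thesis by (simp add: vector_fields_def)
qed

lemma eucl_conn_add_left:
  assumes "X \<in> vector_fields" "X' \<in> vector_fields" "Y \<in> vector_fields" "m \<in> S3xS3"
  shows "eucl_conn (\<lambda>p. X p + X' p) Y m = eucl_conn X Y m + eucl_conn X' Y m"
proof -
  obtain F where F: "(Y has_derivative F) (at m within S3xS3)"
    "\<And>z. z \<in> tangent m \<Longrightarrow> dir_deriv Y m z = F z"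
    using smooth_fun_derivative[OF vector_fieldD(1)[OF assms(3)] assms(4)] by blast
  interpret linear F using F(1) has_derivative_linear by blast
  show ?thesis
    using vector_fieldD(2)[OF assms(1,4)] vector_fieldD(2)[OF assms(2,4)]
    by (simp add: eucl_conn_def F(2) subspace_add[OF tangent_subspace] add tanproj_add)
qed

lemma eucl_conn_scaleR_left:
  assumes "X \<in> vector_fields" "Y \<in> vector_fields" "m \<in> S3xS3"
  shows "eucl_conn (\<lambda>p. f p *\<^sub>R X p) Y m = f m *\<^sub>R eucl_conn X Y m"
proof -
  obtain F where F: "(Y has_derivative F) (at m within S3xS3)"
    "\<And>z. z \<in> tangent m \<Longrightarrow> dir_deriv Y m z = F z"
    using smooth_fun_derivative[OF vector_fieldD(1)[OF assms(2)] assms(3)] by blast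
  interpret linear F using F(1) has_derivative_linear by blast
  show ?thesis
    using vector_fieldD(2)[OF assms(1,3)]
    by (simp add: eucl_conn_def F(2) subspace_scale[OF tangent_subspace] scale tanproj_scaleR)
qed

lemma eucl_conn_add_right:
  assumes "X \<in> vector_fields" "Y \<in> vector_fields" "Y' \<in> vector_fields" "m \<in> S3xS3"
  shows "eucl_conn X (\<lambda>p. Y p + Y' p) m = eucl_conn X Y m + eucl_conn X Y' m"
proof -
  obtain F where F: "(Y has_derivative F) (at m within S3xS3)"
    "\<And>z. z \<in> tangent m \<Longrightarrow> dir_deriv Y m z = F z"
    using smooth_fun_derivative[OF vector_fieldD(1)[OF assms(2)] assms(4)] by blast
  obtain F' where F': "(Y' has_derivative F') (at m within S3xS3)"
    "\<And>z. z \<in> tangent m \<Longrightarrow> dir_deriv Y' m z = F' z"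
    using smooth_fun_derivative[OF vector_fieldD(1)[OF assms(3)] assms(4)] by blast
  note Xm = vector_fieldD(2)[OF assms(1,4)]
  show ?thesis
    using dir_deriv_eqI[OF has_derivative_add[OF F(1) F'(1)] assms(4) Xm]
    by (simp add: eucl_conn_def F(2) F'(2) Xm tanproj_add)
qed

lemma eucl_conn_leibniz:
  assumes "smooth_fun f" "X \<in> vector_fields" "Y \<in> vector_fields" "m \<in> S3xS3"
  shows "eucl_conn X (\<lambda>p. f p *\<^sub>R Y p) m = dir_deriv f m (X m) *\<^sub>R Y m + f m *\<^sub>R eucl_conn X Y m"
proof -
  obtain F where F: "(Y has_derivative F) (at m within S3xS3)"
    "\<And>z. z \<in> tangent m \<Longrightarrow> dir_deriv Y m z = F z"
    using smooth_fun_derivative[OF vector_fieldD(1)[OF assms(3)] assms(4)] by blast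
  obtain F' where F': "(f has_derivative F') (at m within S3xS3)"
    "\<And>z. z \<in> tangent m \<Longrightarrow> dir_deriv f m z = F' z"
    using smooth_fun_derivative[OF assms(1) assms(4)] by blast
  note Xm = vector_fieldD(2)[OF assms(2,4)]
  show ?thesis
    using dir_deriv_eqI[OF has_derivative_scaleR[OF F'(1) F(1)] assms(4) Xm]
      tanproj_tangent[OF assms(4) vector_fieldD(2)[OF assms(3,4)]]
    by (simp add: eucl_conn_def F(2) F'(2) Xm tanproj_add tanproj_scaleR)
qed

lemma eucl_conn_affine: "affine_connection eucl_conn"
  unfolding affine_connection_def
  by (intro conjI ballI allI impI eucl_conn_vector_field eucl_conn_add_left eucl_conn_scaleR_left
      eucl_conn_add_right eucl_conn_leibniz)

text \<open>The bracket is tangent: differentiating \<open>\<langle>Y p, p\<rangle> = 0\<close> gives \<open>\<langle>dY(X), p\<rangle> = - \<langle>Y, X\<rangle>\<close>, which is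
  symmetric in \<open>X\<close> and \<open>Y\<close>.\<close>

lemma lie_bracket_tangent:
  assumes "X \<in> vector_fields" "Y \<in> vector_fields" "m \<in> S3xS3"
  shows "lie_bracket X Y m \<in> tangent m"
proof -
  have *: "inner (fst (dir_deriv Y m (X m))) (fst m) = - inner (fst (Y m)) (fst (X m))"
    "inner (snd (dir_deriv Y m (X m))) (snd m) = - inner (snd (Y m)) (snd (X m))"
    if X: "X \<in> vector_fields" and Y: "Y \<in> vector_fields" for X Y
  proof -
    obtain F where F: "(Y has_derivative F) (at m within S3xS3)"
      "\<And>z. z \<in> tangent m \<Longrightarrow> dir_deriv Y m z = F z"
      using smooth_fun_derivative[OF vector_fieldD(1)[OF Y] assms(3)] by blast
    note Xm = vector_fieldD(2)[OF X assms(3)]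
    have "((\<lambda>p. inner (fst (Y p)) (fst p)) has_derivative
        (\<lambda>h. inner (fst (Y m)) (fst h) + inner (fst (F h)) (fst m))) (at m within S3xS3)"
      by (intro has_derivative_inner has_derivative_fst F(1) has_derivative_ident)
    from dir_deriv_eqI[OF this assms(3) Xm]
    show "inner (fst (dir_deriv Y m (X m))) (fst m) = - inner (fst (Y m)) (fst (X m))"
      using dir_deriv_constI[OF _ assms(3) Xm, of "\<lambda>p. inner (fst (Y p)) (fst p)" 0]
        vector_fieldD(2)[OF Y] by (simp add: F(2)[OF Xm] tangent_iff)
    have "((\<lambda>p. inner (snd (Y p)) (snd p)) has_derivative
        (\<lambda>h. inner (snd (Y m)) (snd h) + inner (snd (F h)) (snd m))) (at m within S3xS3)"
      by (intro has_derivative_inner has_derivative_snd F(1) has_derivative_ident)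
    from dir_deriv_eqI[OF this assms(3) Xm]
    show "inner (snd (dir_deriv Y m (X m))) (snd m) = - inner (snd (Y m)) (snd (X m))"
      using dir_deriv_constI[OF _ assms(3) Xm, of "\<lambda>p. inner (snd (Y p)) (snd p)" 0]
        vector_fieldD(2)[OF Y] by (simp add: F(2)[OF Xm] tangent_iff)
  qed
  show ?thesis
    using *[OF assms(1,2)] *[OF assms(2,1)]
    by (simp add: tangent_iff[OF assms(3)] lie_bracket_def inner_diff_left inner_diff_right inner_commute)
qed

lemma eucl_conn_metric:
  assumes "X \<in> vector_fields" "Y \<in> vector_fields" "Z \<in> vector_fields" "m \<in> S3xS3"
  shows "dir_deriv (\<lambda>p. eucl_product_metric p (Y p) (Z p)) m (X m) =
    eucl_product_metric m (eucl_conn X Y m) (Z m) + eucl_product_metric m (Y m) (eucl_conn X Z m)"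
proof -
  obtain F where F: "(Y has_derivative F) (at m within S3xS3)"
    "\<And>z. z \<in> tangent m \<Longrightarrow> dir_deriv Y m z = F z"
    using smooth_fun_derivative[OF vector_fieldD(1)[OF assms(2)] assms(4)] by blast
  obtain G where G: "(Z has_derivative G) (at m within S3xS3)"
    "\<And>z. z \<in> tangent m \<Longrightarrow> dir_deriv Z m z = G z"
    using smooth_fun_derivative[OF vector_fieldD(1)[OF assms(3)] assms(4)] by blast
  note Xm = vector_fieldD(2)[OF assms(1,4)]
  show ?thesis
    using dir_deriv_eqI[OF has_derivative_inner[OF F(1) G(1)] assms(4) Xm]
      inner_tanproj[OF assms(4) vector_fieldD(2)[OF assms(2,4)]]
      inner_tanproj[OF assms(4) vector_fieldD(2)[OF assms(3,4)]]
    by (simp add: eucl_product_metric_def eucl_conn_def F(2) G(2) Xm inner_commute[of "Y m"] add.commute)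
qed

lemma eucl_conn_levi_civita: "levi_civita eucl_product_metric eucl_conn"
  unfolding levi_civita_def
proof (intro conjI ballI eucl_conn_affine eucl_conn_metric)
  fix X Y m assume "X \<in> vector_fields" "Y \<in> vector_fields" "m \<in> S3xS3"
  then show "eucl_conn X Y m - eucl_conn Y X m = lie_bracket X Y m"
    using tanproj_tangent[OF _ lie_bracket_tangent, of m X Y]
    by (simp add: eucl_conn_def lie_bracket_def tanproj_diff)
qed

lemma eucl_covariant_derivative_along:
  assumes \<gamma>: "smooth_curve \<gamma>"
  shows "covariant_derivative_along eucl_conn \<gamma> (\<lambda>V t. tanproj (\<gamma> t) (vector_derivative V (at t)))"
  unfolding covariant_derivative_along_def
proof (intro conjI ballI allI impI)
  have s: "smooth_on UNIV \<gamma>" and r: "\<gamma> t \<in> S3xS3" for t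
    using \<gamma> by (auto simp: smooth_curve_def)
  have V: "smooth_on UNIV V" if "V \<in> fields_along \<gamma>" for V using that by (simp add: fields_along_def)
  note vd = smooth_on_vector_derivative(1)[OF V]
  show "(\<lambda>t. tanproj (\<gamma> t) (vector_derivative V (at t))) \<in> fields_along \<gamma>" if "V \<in> fields_along \<gamma>" for V
    unfolding fields_along_def
    using tanproj_in_tangent[OF r] smooth_on_tanproj[OF open_UNIV s smooth_on_vector_derivative(3)[OF V[OF that]]]
    by blast
  fix V t assume v: "V \<in> fields_along \<gamma>"
  show "tanproj (\<gamma> t) (vector_derivative (\<lambda>t. V t + W t) (at t)) =
      tanproj (\<gamma> t) (vector_derivative V (at t)) + tanproj (\<gamma> t) (vector_derivative W (at t))"
    if "W \<in> fields_along \<gamma>" for W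
    using vector_derivative_at[OF has_vector_derivative_add[OF vd[OF v] vd[OF that]]]
    by (simp add: tanproj_add)
  show "tanproj (\<gamma> t) (vector_derivative (\<lambda>t. f t *\<^sub>R V t) (at t)) =
      deriv f t *\<^sub>R V t + f t *\<^sub>R tanproj (\<gamma> t) (vector_derivative V (at t))"
    if "smooth_on UNIV f" for f
  proof -
    have "f differentiable at t"
      using smooth_on_has_derivative[OF that UNIV_I] unfolding differentiable_def by blast
    then have "(f has_real_derivative deriv f t) (at t)"
      using DERIV_deriv_iff_real_differentiable by blast
    from vector_derivative_at[OF has_vector_derivative_scaleR[OF this vd[OF v]]] show ?thesis
      using v tanproj_tangent[OF r, of "V t"]
      by (simp add: tanproj_add tanproj_scaleR fields_along_def)
  qed
next
  fix X Y t assume X: "X \<in> vector_fields" and Y: "Y \<in> vector_fields" and eq: "X (\<gamma> t) = velocity \<gamma> t"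
  have s: "smooth_on UNIV \<gamma>" and r: "\<gamma> t \<in> S3xS3" "range \<gamma> \<subseteq> S3xS3"
    using \<gamma> by (auto simp: smooth_curve_def)
  obtain F where F: "(Y has_derivative F) (at (\<gamma> t) within S3xS3)"
    "\<And>z. z \<in> tangent (\<gamma> t) \<Longrightarrow> dir_deriv Y (\<gamma> t) z = F z"
    using smooth_fun_derivative[OF vector_fieldD(1)[OF Y] r(1)] by blast
  have Xm: "velocity \<gamma> t \<in> tangent (\<gamma> t)" using vector_fieldD(2)[OF X r(1)] by (simp add: eq)
  have "(\<gamma> has_derivative (\<lambda>h. h *\<^sub>R velocity \<gamma> t)) (at t)"
    using smooth_on_vector_derivative(1)[OF s, of t] by (simp add: velocity_def has_vector_derivative_def)
  \<comment> \<open>The curve stays in \<open>S3xS3\<close>, so a derivative of \<open>Y\<close>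
    within \<open>S3xS3\<close> is enough for the chain rule.\<close>
  from has_derivative_in_compose[OF this has_derivative_subset[OF F(1) r(2)]]
  have "((\<lambda>t. Y (\<gamma> t)) has_vector_derivative F (velocity \<gamma> t)) (at t)"
    using linear_cmul[OF has_derivative_linear[OF F(1)]] by (simp add: has_vector_derivative_def)
  then show "tanproj (\<gamma> t) (vector_derivative (\<lambda>t. Y (\<gamma> t)) (at t)) = eucl_conn X Y (\<gamma> t)"
    using F(2)[OF Xm] by (simp add: eucl_conn_def eq vector_derivative_at)
qed

lemma geodesic_euclI:
  assumes "smooth_curve \<gamma>" "\<And>t. tanproj (\<gamma> t) (vector_derivative (velocity \<gamma>) (at t)) = 0"
  shows "geodesic eucl_product_metric \<gamma>"
  unfolding geodesic_def
  using assms eucl_conn_levi_civita eucl_covariant_derivative_along[OF assms(1)] by blast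

section \<open>The geodesic equations\<close>

text \<open>The nearly Kaehler metric read in the left trivialisation, where the base point has
  disappeared; this is its left-invariance.\<close>

definition nK_form :: "quat \<times> quat \<Rightarrow> quat \<times> quat \<Rightarrow> real"
  where "nK_form \<xi> \<eta> = 4 / 3 * (inner (fst \<xi>) (fst \<eta>) + inner (snd \<xi>) (snd \<eta>))
    - 2 / 3 * (inner (fst \<xi>) (snd \<eta>) + inner (fst \<eta>) (snd \<xi>))"

lemma nK_metric_linv:
  assumes "m \<in> S3xS3"
  shows "nK_metric m (linv \<xi> m) (linv \<eta> m) = nK_form \<xi> \<eta>"
proof -
  obtain p q where m: "m = (p, q)" by (cases m)
  have n: "norm p = 1" "norm q = 1" "p \<noteq> 0" "q \<noteq> 0" using assms by (auto simp: S3xS3_iff m)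
  show ?thesis
    using nK_metric_explicit[OF assms[unfolded m]] n
    by (simp add: m linv_def nK_form_def inner_quat_mult_left mult.assoc[symmetric])
qed

lemma bilinear_nK_form: "bilinear nK_form"
  unfolding bilinear_def nK_form_def
  by (auto intro!: linearI simp: inner_add_left inner_add_right add_divide_distrib inner_commute algebra_simps)

text \<open>Bracketing with an imaginary quaternion is skew-symmetric. It moves the bracket in the
  Euler-Arnold equation off the test vector.\<close>

lemma inner_commutator:
  "a \<in> ImH \<Longrightarrow> inner b (a * z - z * a) = inner (b * a - a * b) z" for a b z :: quat
  by (simp add: inner_quat_def ImH_def algebra_simps)

lemma ImH_eq_0I:
  assumes "w \<in> ImH" "\<And>z. z \<in> ImH \<Longrightarrow> inner w z = 0"
  shows "w = 0"
  using assms(2)[OF assms(1)] by simp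

text \<open>The test vectors \<open>(z, 0)\<close> and \<open>(0, z)\<close> give 2 A - B = w and 2
  B - A = -w, where A and B are the derivatives of \<alpha> and \<beta> and w is their commutator;
  solving this system produces the factor 1/3.\<close>

lemma nK_geodesic_ode:
  assumes geo: "geodesic nK_metric \<gamma>"
    and vel: "\<And>t. velocity \<gamma> t = linv (\<alpha> t, \<beta> t) (\<gamma> t)" "\<And>t. \<alpha> t \<in> ImH" "\<And>t. \<beta> t \<in> ImH"
  shows "(\<alpha> has_vector_derivative (1 / 3) *\<^sub>R (\<alpha> t * \<beta> t - \<beta> t * \<alpha> t)) (at t)"
    and "(\<beta> has_vector_derivative (1 / 3) *\<^sub>R (\<beta> t * \<alpha> t - \<alpha> t * \<beta> t)) (at t)"
proof -
  obtain \<xi>' where d: "((\<lambda>t. (\<alpha> t, \<beta> t)) has_vector_derivative \<xi>') (at t)" and Im: "\<xi>' \<in> ImH \<times> ImH"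
    and eq: "\<And>\<zeta>. \<zeta> \<in> ImH \<times> ImH \<Longrightarrow> nK_form \<xi>' \<zeta> = nK_form (\<alpha> t, \<beta> t) (brk (\<alpha> t, \<beta> t) \<zeta>)"
    by (rule geodesic_euler_arnold[OF geo, of "\<lambda>t. (\<alpha> t, \<beta> t)" nK_form t])
      (use vel nK_metric_linv bilinear_nK_form in \<open>auto simp: nK_form_def inner_commute\<close>)
  define A B w where "A = fst \<xi>'" and "B = snd \<xi>'" and "w = \<alpha> t * \<beta> t - \<beta> t * \<alpha> t"
  have AB: "A \<in> ImH" "B \<in> ImH" "\<xi>' = (A, B)" using Im by (auto simp: A_def B_def mem_Times_iff)
  have w: "w \<in> ImH" by (simp add: w_def)
  have "2 *\<^sub>R A - B - w = 0"
  proof (rule ImH_eq_0I)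
    fix z assume z: "z \<in> ImH"
    have "nK_form (A, B) (z, 0) = nK_form (\<alpha> t, \<beta> t) (\<alpha> t * z - z * \<alpha> t, 0)"
      using eq[of "(z, 0)"] z AB(3) by (simp add: brk_def)
    also have "\<dots> = - 2 / 3 * inner (- w) z"
      using inner_commutator[OF vel(2)[of t], of "\<alpha> t" z] inner_commutator[OF vel(2)[of t], of "\<beta> t" z]
      by (simp add: nK_form_def w_def inner_commute)
    finally show "inner (2 *\<^sub>R A - B - w) z = 0"
      by (simp add: nK_form_def inner_diff_left inner_commute[of z])
  qed (use AB w in auto)
  moreover have "2 *\<^sub>R B - A + w = 0"
  proof (rule ImH_eq_0I)
    fix z assume z: "z \<in> ImH"
    have "nK_form (A, B) (0, z) = nK_form (\<alpha> t, \<beta> t) (0, \<beta> t * z - z * \<beta> t)"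
      using eq[of "(0, z)"] z AB(3) by (simp add: brk_def)
    also have "\<dots> = - 2 / 3 * inner w z"
      using inner_commutator[OF vel(3)[of t], of "\<alpha> t" z] inner_commutator[OF vel(3)[of t], of "\<beta> t" z]
      by (simp add: nK_form_def w_def inner_commute)
    finally show "inner (2 *\<^sub>R B - A + w) z = 0"
      by (simp add: nK_form_def inner_diff_left inner_add_left inner_commute[of z])
  qed (use AB w in auto)
  ultimately have "A = (1 / 3) *\<^sub>R w" "B = (1 / 3) *\<^sub>R (- w)"
    by (simp_all add: quat_eq_iff)
  moreover have "(\<alpha> has_vector_derivative A) (at t)" "(\<beta> has_vector_derivative B) (at t)"
    using bounded_linear.has_vector_derivative[OF bounded_linear_fst d]
      bounded_linear.has_vector_derivative[OF bounded_linear_snd d] by (simp_all add: A_def B_def)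
  ultimately show "(\<alpha> has_vector_derivative (1 / 3) *\<^sub>R (\<alpha> t * \<beta> t - \<beta> t * \<alpha> t)) (at t)"
    "(\<beta> has_vector_derivative (1 / 3) *\<^sub>R (\<beta> t * \<alpha> t - \<alpha> t * \<beta> t)) (at t)"
    by (simp_all add: w_def)
qed

text \<open>The Euclidean product metric is bi-invariant, so the right-hand side of the Euler-Arnold
  equation vanishes; testing with \<open>\<xi>'\<close> itself shows that its norm is 0.\<close>

lemma eucl_geodesic_ode:
  assumes geo: "geodesic eucl_product_metric \<gamma>"
    and vel: "\<And>t. velocity \<gamma> t = linv (\<xi> t) (\<gamma> t)" "\<And>t. \<xi> t \<in> ImH \<times> ImH"
  shows "(\<xi> has_vector_derivative 0) (at t)"
proof -
  obtain \<xi>' where d: "(\<xi> has_vector_derivative \<xi>') (at t)" and Im: "\<xi>' \<in> ImH \<times> ImH"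
    and eq: "\<And>\<zeta>. \<zeta> \<in> ImH \<times> ImH \<Longrightarrow> inner \<xi>' \<zeta> = inner (\<xi> t) (brk (\<xi> t) \<zeta>)"
    by (rule geodesic_euler_arnold[OF geo vel, of inner t])
      (auto simp: eucl_product_metric_def inner_linv inner_commute
        intro: bilinear_conv_bounded_bilinear[THEN iffD2] bounded_bilinear_inner)
  have "inner \<xi>' \<xi>' = inner (\<xi> t) (brk (\<xi> t) \<xi>')" by (rule eq[OF Im])
  also have "\<dots> = 0"
    using vel(2)[of t] inner_commutator[of "fst (\<xi> t)" "fst (\<xi> t)" "fst \<xi>'"]
      inner_commutator[of "snd (\<xi> t)" "snd (\<xi> t)" "snd \<xi>'"]
    by (simp add: brk_def inner_prod_def mem_Times_iff)
  finally have "\<xi>' = 0" by simp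
  with d show ?thesis by simp
qed

text \<open>In the frame rotating with \<open>exp (t v)\<close> the equation \<open>\<alpha>' = [\<alpha>, v]\<close> becomes trivial.\<close>

lemma rotating_frame_solution:
  fixes x \<alpha> :: "real \<Rightarrow> quat"
  assumes x: "\<And>t. (x has_vector_derivative x t * \<alpha> t) (at t)"
    and \<alpha>: "\<And>t. (\<alpha> has_vector_derivative \<alpha> t * v - v * \<alpha> t) (at t)"
  shows "\<alpha> t = exp (- (t *\<^sub>R v)) * \<alpha> 0 * exp (t *\<^sub>R v)"
    and "x t = x 0 * exp (t *\<^sub>R (\<alpha> 0 - v)) * exp (t *\<^sub>R v)"
proof -
  have inv: "exp (t *\<^sub>R w) * exp (- (t *\<^sub>R w)) = 1" "exp (- (t *\<^sub>R w)) * exp (t *\<^sub>R w) = 1" for t and w :: quat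
    using exp_minus_inverse[of "t *\<^sub>R w"] exp_minus_inverse[of "- (t *\<^sub>R w)"] by simp_all
  have R: "((\<lambda>t. exp (- (t *\<^sub>R w))) has_vector_derivative - w * exp (- (t *\<^sub>R w))) (at t)" for t and w :: quat
    using exp_scaleR_derivative_left[of "- w" t] by simp
  have "((\<lambda>t. exp (t *\<^sub>R v) * \<alpha> t * exp (- (t *\<^sub>R v))) has_vector_derivative
      (exp (t *\<^sub>R v) * \<alpha> t) * (- v * exp (- (t *\<^sub>R v)))
      + (exp (t *\<^sub>R v) * (\<alpha> t * v - v * \<alpha> t) + (exp (t *\<^sub>R v) * v) * \<alpha> t) * exp (- (t *\<^sub>R v))) (at t)" for t
    by (intro has_vector_derivative_mult exp_scaleR_has_vector_derivative_right \<alpha> R)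
  then have "((\<lambda>t. exp (t *\<^sub>R v) * \<alpha> t * exp (- (t *\<^sub>R v))) has_vector_derivative 0) (at t)" for t
    by (simp add: algebra_simps)
  from vector_derivative_zero_imp_eq[OF this, of _ 0]
  have c: "exp (t *\<^sub>R v) * \<alpha> t * exp (- (t *\<^sub>R v)) = \<alpha> 0" for t by simp
  show \<alpha>t: "\<alpha> t = exp (- (t *\<^sub>R v)) * \<alpha> 0 * exp (t *\<^sub>R v)" for t
  proof -
    have "exp (- (t *\<^sub>R v)) * \<alpha> 0 * exp (t *\<^sub>R v)
        = (exp (- (t *\<^sub>R v)) * exp (t *\<^sub>R v)) * \<alpha> t * (exp (- (t *\<^sub>R v)) * exp (t *\<^sub>R v))"
      unfolding c[of t, symmetric] by (simp only: mult.assoc)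
    then show ?thesis by (simp add: inv)
  qed
  define u where "u = \<alpha> 0 - v"
  \<comment> \<open>Moving \<open>u\<close> past the rotation turns it into
    \<open>\<alpha> t - v\<close>, which makes the terms of the following derivative cancel.\<close>
  have e: "exp (- (t *\<^sub>R v)) * u = (\<alpha> t - v) * exp (- (t *\<^sub>R v))" for t
  proof -
    have "\<alpha> t * exp (- (t *\<^sub>R v)) = exp (- (t *\<^sub>R v)) * \<alpha> 0 * (exp (t *\<^sub>R v) * exp (- (t *\<^sub>R v)))"
      by (subst \<alpha>t) (simp only: mult.assoc)
    moreover have "v * exp (- (t *\<^sub>R v)) = exp (- (t *\<^sub>R v)) * v"
      using exp_times_scaleR_commute[of "-t" v] by simp
    ultimately show ?thesis by (simp add: inv u_def algebra_simps)
  qed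
  have "((\<lambda>t. x t * exp (- (t *\<^sub>R v)) * exp (- (t *\<^sub>R u))) has_vector_derivative
      (x t * exp (- (t *\<^sub>R v))) * (- u * exp (- (t *\<^sub>R u)))
      + (x t * (- v * exp (- (t *\<^sub>R v))) + (x t * \<alpha> t) * exp (- (t *\<^sub>R v))) * exp (- (t *\<^sub>R u))) (at t)" for t
    by (intro has_vector_derivative_mult R x)
  moreover have "(x t * exp (- (t *\<^sub>R v))) * (- u * exp (- (t *\<^sub>R u)))
      = - (x t * (exp (- (t *\<^sub>R v)) * u) * exp (- (t *\<^sub>R u)))" for t by (simp add: mult.assoc)
  ultimately have "((\<lambda>t. x t * exp (- (t *\<^sub>R v)) * exp (- (t *\<^sub>R u))) has_vector_derivative 0) (at t)" for t
    by (simp add: e algebra_simps)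
  from vector_derivative_zero_imp_eq[OF this, of t 0]
  have "x t * exp (- (t *\<^sub>R v)) * exp (- (t *\<^sub>R u)) = x 0" by simp
  from this[symmetric] have "x 0 * exp (t *\<^sub>R u) * exp (t *\<^sub>R v)
      = x t * (exp (- (t *\<^sub>R v)) * ((exp (- (t *\<^sub>R u)) * exp (t *\<^sub>R u)) * exp (t *\<^sub>R v)))"
    by (simp only: mult.assoc)
  then show "x t = x 0 * exp (t *\<^sub>R (\<alpha> 0 - v)) * exp (t *\<^sub>R v)" by (simp add: inv u_def)
qed

text \<open>The additional factors exp (T u) and exp (T v) can be made adjacent in the middle, since
  exp (T u) commutes with exp (t u) and exp (T v) with exp (t v). Hence the condition at t = 0
  yields all t.\<close>

lemma exp_product_periodic_iff:
  fixes u v x0 :: quat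
  assumes "x0 \<noteq> 0"
  shows "(\<forall>t. x0 * exp ((t + T) *\<^sub>R u) * exp ((t + T) *\<^sub>R v) = x0 * exp (t *\<^sub>R u) * exp (t *\<^sub>R v))
    \<longleftrightarrow> exp (T *\<^sub>R u) * exp (T *\<^sub>R v) = 1" (is "?L \<longleftrightarrow> ?R")
proof
  assume ?L
  from this[rule_format, of 0] show ?R using assms by (simp add: mult.assoc)
next
  assume R: ?R
  have 1: "exp ((t + T) *\<^sub>R u) = exp (t *\<^sub>R u) * exp (T *\<^sub>R u)" for t
    by (simp add: scaleR_add_left exp_add_commuting)
  have 2: "exp ((t + T) *\<^sub>R v) = exp (T *\<^sub>R v) * exp (t *\<^sub>R v)" for t
    by (simp add: scaleR_add_left exp_add_commuting add.commute[of t T])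
  have "x0 * exp ((t + T) *\<^sub>R u) * exp ((t + T) *\<^sub>R v) =
      x0 * exp (t *\<^sub>R u) * (exp (T *\<^sub>R u) * exp (T *\<^sub>R v)) * exp (t *\<^sub>R v)" for t
    unfolding 1 2 by (simp only: mult.assoc)
  then show ?L using R by simp
qed

section \<open>Periods\<close>

lemma exp_scaleR_ImH:
  assumes "u \<in> ImH" "T > 0"
  shows "exp (T *\<^sub>R u) = cos (T * norm u) *\<^sub>R 1 + (sin (T * norm u) / norm u) *\<^sub>R u"
  using exp_ImH[of "T *\<^sub>R u"] assms by simp

lemma exp_scaleR_ImH_eq_1_iff:
  assumes "u \<in> ImH" "T > 0"
  shows "exp (T *\<^sub>R u) = 1 \<longleftrightarrow> cos (T * norm u) = 1"
proof
  assume "exp (T *\<^sub>R u) = 1"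
  then have "qRe (exp (T *\<^sub>R u)) = 1" by simp
  then show "cos (T * norm u) = 1" using assms by (simp add: exp_scaleR_ImH) (simp add: ImH_def)
next
  assume c: "cos (T * norm u) = 1"
  then have "sin (T * norm u) = 0" using sin_cos_squared_add[of "T * norm u"] by simp
  with c show "exp (T *\<^sub>R u) = 1" using assms by (simp add: exp_scaleR_ImH)
qed

text \<open>Compare exp (T u) with exp (-T v): the real parts give equal cosines, and by linear
  independence of \<open>u\<close> and \<open>v\<close> both imaginary coefficients must
  vanish.\<close>

lemma exp_mult_exp_eq_1_iff:
  assumes u: "u \<in> ImH" and v: "v \<in> ImH" and T: "T > 0" and ind: "v \<noteq> 0" "\<And>k. u \<noteq> k *\<^sub>R v"
  shows "exp (T *\<^sub>R u) * exp (T *\<^sub>R v) = 1 \<longleftrightarrow>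
    sin (T * norm u) = 0 \<and> sin (T * norm v) = 0 \<and> cos (T * norm u) = cos (T * norm v)"
proof -
  have "exp (T *\<^sub>R u) * exp (T *\<^sub>R v) = 1 \<longleftrightarrow> exp (T *\<^sub>R u) = exp (T *\<^sub>R - v)"
  proof
    assume "exp (T *\<^sub>R u) * exp (T *\<^sub>R v) = 1"
    then have "exp (T *\<^sub>R u) * (exp (T *\<^sub>R v) * exp (- (T *\<^sub>R v))) = exp (- (T *\<^sub>R v))"
      by (simp add: mult.assoc[symmetric])
    then show "exp (T *\<^sub>R u) = exp (T *\<^sub>R - v)" by (simp add: exp_minus_inverse)
  next
    assume "exp (T *\<^sub>R u) = exp (T *\<^sub>R - v)"
    then show "exp (T *\<^sub>R u) * exp (T *\<^sub>R v) = 1"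
      using exp_minus_inverse[of "- (T *\<^sub>R v)"] by simp
  qed
  also have "\<dots> \<longleftrightarrow> cos (T * norm u) *\<^sub>R 1 + (sin (T * norm u) / norm u) *\<^sub>R u
      = cos (T * norm v) *\<^sub>R 1 - (sin (T * norm v) / norm v) *\<^sub>R v"
    using exp_scaleR_ImH[OF u T] exp_scaleR_ImH[of "- v" T] v T by simp
  also have "\<dots> \<longleftrightarrow> sin (T * norm u) = 0 \<and> sin (T * norm v) = 0 \<and> cos (T * norm u) = cos (T * norm v)"
    (is "?L \<longleftrightarrow> ?R")
  proof
    assume eq: ?L
    then have "qRe (cos (T * norm u) *\<^sub>R 1 + (sin (T * norm u) / norm u) *\<^sub>R u)
      = qRe (cos (T * norm v) *\<^sub>R 1 - (sin (T * norm v) / norm v) *\<^sub>R v)" by (rule arg_cong)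
    then have c: "cos (T * norm u) = cos (T * norm v)" using u v by (simp add: ImH_def)
    with eq have s: "(sin (T * norm u) / norm u) *\<^sub>R u = (- (sin (T * norm v) / norm v)) *\<^sub>R v"
      by simp
    have "u \<noteq> 0" using ind(2)[of 0] by simp
    define k l where "k = sin (T * norm u) / norm u" and "l = - (sin (T * norm v) / norm v)"
    have kl: "k *\<^sub>R u = l *\<^sub>R v" using s by (simp add: k_def l_def)
    have "k = 0"
    proof (rule ccontr)
      assume "k \<noteq> 0"
      then have "u = (1 / k) *\<^sub>R (k *\<^sub>R u)" by simp
      then have "u = (l / k) *\<^sub>R v" by (simp add: kl)
      then show False using ind(2) by blast
    qed
    with kl ind(1) have "l = 0" by simp
    with \<open>k = 0\<close> \<open>u \<noteq> 0\<close> ind(1) c show ?R by (simp add: k_def l_def)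
  qed simp
  finally show ?thesis .
qed

lemma common_period_iff:
  fixes U U' V :: real
  assumes "U > 0" "U' > 0" "V > 0"
  shows "(\<exists>T>0. (sin (T * U) = 0 \<and> sin (T * V) = 0 \<and> cos (T * U) = cos (T * V))
      \<and> (sin (T * U') = 0 \<and> sin (T * V) = 0 \<and> cos (T * U') = cos (T * V)))
    \<longleftrightarrow> U / V \<in> \<rat> \<and> U' / V \<in> \<rat>" (is "?L \<longleftrightarrow> ?R")
proof
  assume ?L
  then obtain T i i' j where T: "T > 0"
    "T * U = of_int i * pi" "T * U' = of_int i' * pi" "T * V = of_int j * pi"
    by (auto simp: sin_zero_iff_int2)
  have "U / V = (T * U) / (T * V)" "U' / V = (T * U') / (T * V)" using T(1) by simp_all
  then show ?R unfolding T by simp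
next
  assume ?R
  then obtain i j i' j' where r: "U / V = of_int i / of_int j" "U' / V = of_int i' / of_int j'"
    and j: "j > 0" "j' > 0"
    using Rats_cases' by metis
  \<comment> \<open>The product of the denominators clears both fractions. The factor 2 makes all
    three multiples of pi even, so the parity condition expressed by the cosines holds
    automatically.\<close>
  define T where "T = 2 * pi * of_int (j * j') / V"
  have "T > 0" using j assms by (simp add: T_def)
  have "U = V * of_int i / of_int j" "U' = V * of_int i' / of_int j'"
    using r assms by (simp_all add: field_simps)
  then have "T * U = 2 * pi * of_int (i * j')" "T * U' = 2 * pi * of_int (i' * j)"
    "T * V = 2 * pi * of_int (j * j')"
    using j assms by (simp_all add: T_def)
  then show ?L using \<open>T > 0\<close> by (intro exI[of _ T]) (simp only: cos_int_2pin sin_int_2pin simp_thms)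
qed

text \<open>A vanishing frequency is compatible with every T, which is exactly what the convention
  for zero entries of a fraction encodes.\<close>

lemma rational_fraction_iff_common_period:
  "rational_fraction a a' \<longleftrightarrow> (\<exists>T>0. cos (T * a) = 1 \<and> cos (T * a') = 1)" (is "?L \<longleftrightarrow> ?R")
proof
  assume ?R
  then obtain T i j where T: "T > 0" "T * a = of_int i * 2 * pi" "T * a' = of_int j * 2 * pi"
    by (auto simp: cos_one_2pi_int)
  have "a / a' = (T * a) / (T * a')" using T(1) by simp
  also have "\<dots> \<in> \<rat>" unfolding T by simp
  finally show ?L by (simp add: rational_fraction_def)
next
  have one: "\<exists>T>0. cos (T * r) = 1" for r :: real
  proof (cases "r = 0")
    case False
    then show ?thesis
      by (intro exI[of _ "2 * pi / \<bar>r\<bar>"]) (cases "r > 0"; simp add: divide_less_0_iff)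
  qed (auto intro: exI[of _ 1])
  assume L: ?L
  show ?R
  proof (cases "a = 0 \<or> a' = 0")
    case True
    then show ?thesis using one[of a] one[of a'] by auto
  next
    case False
    then have "a / a' \<in> \<rat>" using L by (simp add: rational_fraction_def)
    then obtain i j where r: "a / a' = of_int i / of_int j" and j: "j > 0"
      using Rats_cases' by metis
    \<comment> \<open>The sign \<open>s\<close> compensates a negative \<open>a'\<close>, so that
      the period defined next is positive.\<close>
    obtain s :: int where s: "s \<noteq> 0" "of_int s / a' > 0"
      using False by (intro that[of "if a' > 0 then 1 else -1"]) auto
    define T where "T = 2 * pi * of_int (j * s) / a'"
    have "T = (2 * pi * of_int j) * (of_int s / a')" by (simp add: T_def)
    also have "\<dots> > 0" by (rule mult_pos_pos) (use s j in simp_all)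
    finally have "T > 0" .
    have "a = a' * of_int i / of_int j" using r False by (simp add: field_simps)
    then have "T * a = 2 * pi * of_int (i * s)" "T * a' = 2 * pi * of_int (j * s)"
      using j False by (simp_all add: T_def)
    then show ?thesis using \<open>T > 0\<close> by (intro exI[of _ T]) (simp only: cos_int_2pin simp_thms)
  qed
qed

text \<open>The Moebius map r -> (1 - r) / (1 + r) is an involution preserving rationality, and it
  exchanges U / V with the given fraction. For U = V that fraction is 0, in agreement with the zero
  convention.\<close>

lemma rational_fraction_diff_sum_iff:
  fixes U V :: real
  assumes "U > 0" "V > 0"
  shows "rational_fraction (V - U) (V + U) \<longleftrightarrow> U / V \<in> \<rat>"
proof -
  define r where "r = (V - U) / (V + U)"
  have s: "V + U > 0" using assms by simp
  have "U / V = (1 - r) / (1 + r)" "r = (1 - U / V) / (1 + U / V)"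
    using assms s by (simp_all add: r_def divide_simps)
  then have "r \<in> \<rat> \<longleftrightarrow> U / V \<in> \<rat>"
    by (metis Rats_1 Rats_add Rats_diff Rats_divide)
  moreover have "rational_fraction (V - U) (V + U) \<longleftrightarrow> r \<in> \<rat>"
    using s by (auto simp: rational_fraction_def r_def)
  ultimately show ?thesis by simp
qed

text \<open>Orthogonal imaginary quaternions anticommute; if they also commute, their product is 0
  in a division algebra.\<close>

lemma ImH_orthogonal_commute:
  assumes "u \<in> ImH" "v \<in> ImH" "inner u v = 0" "u * v = v * u" "v \<noteq> 0"
  shows "u = 0"
proof -
  have "u * v + v * u = (- 2 * inner u v) *\<^sub>R 1"
    using assms(1,2) by (simp add: quat_eq_iff ImH_def inner_quat_def)
  then have "2 *\<^sub>R (u * v) = 0" using assms(3,4) by (simp add: scaleR_2)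
  then show ?thesis using assms(5) by simp
qed

lemma norm_orthogonal_combination:
  fixes c1 c2 :: quat
  assumes "inner c2 c1 = 0"
  shows "(norm (k *\<^sub>R c1 + l *\<^sub>R c2))\<^sup>2 = k\<^sup>2 * (norm c1)\<^sup>2 + l\<^sup>2 * (norm c2)\<^sup>2"
  using assms unfolding power2_norm_eq_inner
  by (simp add: inner_add_left inner_add_right inner_commute[of c1 c2] power2_eq_square)

section \<open>Classification of the geodesics\<close>

text \<open>Primed constants stand for those with a tilde. All data besides \<open>c1\<close> are
  constrained only when \<open>c1\<close> is nonzero, hence the guards in the conclusion.\<close>

theorem proposition3p1:
  fixes \<gamma> :: "real \<Rightarrow> quat \<times> quat" and x y \<alpha> \<beta> :: "real \<Rightarrow> quat"
    and c1 c2 :: quat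
    and d1 a a' b b' c c' A B A' B' :: real
  assumes \<gamma>: "\<gamma> = (\<lambda>t. (x t, y t))"
    and geodesic: "geodesic nK_metric \<gamma>"
    and nonconstant: "\<not> \<gamma> constant_on UNIV"
    and Im: "\<And>t. \<alpha> t \<in> ImH" "\<And>t. \<beta> t \<in> ImH"
    and velocity: "\<And>t. velocity \<gamma> t = (x t * \<alpha> t, y t * \<beta> t)"
    and c1: "c1 = \<alpha> 0 + \<beta> 0"
    and d1: "c1 \<noteq> 0 \<Longrightarrow> d1 = inner (\<alpha> 0 - \<beta> 0) c1 / (norm c1)\<^sup>2"
    and c2: "c1 \<noteq> 0 \<Longrightarrow> c2 = \<alpha> 0 - \<beta> 0 - d1 *\<^sub>R c1"
    and a: "c1 \<noteq> 0 \<Longrightarrow> a = (1 + d1) / 2 * norm c1"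
    and a': "c1 \<noteq> 0 \<Longrightarrow> a' = (1 - d1) / 2 * norm c1"
    and b: "c1 \<noteq> 0 \<Longrightarrow> b = 1 / 2 * norm c2"
    and b': "c1 \<noteq> 0 \<Longrightarrow> b' = - 1 / 2 * norm c2"
    and c: "c1 \<noteq> 0 \<Longrightarrow> c = 2 / 3 * norm c1"
    and c': "c1 \<noteq> 0 \<Longrightarrow> c' = 2 / 3 * norm c1"
    and A: "c1 \<noteq> 0 \<Longrightarrow> A = (c + sqrt ((2 * a - c)\<^sup>2 + 4 * b\<^sup>2)) / 2"
    and B: "c1 \<noteq> 0 \<Longrightarrow> B = (c - sqrt ((2 * a - c)\<^sup>2 + 4 * b\<^sup>2)) / 2"
    and A': "c1 \<noteq> 0 \<Longrightarrow> A' = (c' + sqrt ((2 * a' - c')\<^sup>2 + 4 * b'\<^sup>2)) / 2"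
    and B': "c1 \<noteq> 0 \<Longrightarrow> B' = (c' - sqrt ((2 * a' - c')\<^sup>2 + 4 * b'\<^sup>2)) / 2"
  shows "(geodesic eucl_product_metric \<gamma> \<longleftrightarrow> c1 = 0 \<or> (c1 \<noteq> 0 \<and> c2 = 0))
    \<and> ((\<forall>t. nK_P (\<gamma> t) (velocity \<gamma> t) = - velocity \<gamma> t) \<longleftrightarrow> c1 = 0)
    \<and> ((\<forall>t. nK_P (\<gamma> t) (velocity \<gamma> t) = velocity \<gamma> t) \<longleftrightarrow> c1 \<noteq> 0 \<and> c2 = 0 \<and> d1 = 0)
    \<and> (closed_curve \<gamma> \<longleftrightarrow>
         c1 = 0
       \<or> (c1 \<noteq> 0 \<and> c2 = 0 \<and> rational_fraction a a')
       \<or> (c1 \<noteq> 0 \<and> c2 \<noteq> 0 \<and> rational_fraction B A \<and> rational_fraction B' A'))"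
proof -

  \<comment> \<open>Equations of motion and their solution\<close>
  have smooth: "smooth_curve \<gamma>" using geodesic by (simp add: geodesic_def)
  then have S: "\<gamma> t \<in> S3xS3" and sm: "smooth_on UNIV \<gamma>" for t by (auto simp: smooth_curve_def)
  have n: "norm (x t) = 1" "norm (y t) = 1" "x t \<noteq> 0" "y t \<noteq> 0" for t
    using S[of t] by (auto simp: \<gamma> S3xS3_iff)
  have vel: "velocity \<gamma> t = linv (\<alpha> t, \<beta> t) (\<gamma> t)" for t by (simp add: \<gamma> velocity[unfolded \<gamma>])
  have d\<gamma>: "(\<gamma> has_vector_derivative (x t * \<alpha> t, y t * \<beta> t)) (at t)" for t
    using smooth_on_vector_derivative(1)[OF sm, of t] velocity[of t] by (simp add: velocity_def)
  have dx: "(x has_vector_derivative x t * \<alpha> t) (at t)"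
    and dy: "(y has_vector_derivative y t * \<beta> t) (at t)" for t
    using bounded_linear.has_vector_derivative[OF bounded_linear_fst d\<gamma>[of t]]
      bounded_linear.has_vector_derivative[OF bounded_linear_snd d\<gamma>[of t]] by (simp_all add: \<gamma>)
  note ode = nK_geodesic_ode[OF geodesic vel Im]
  have "((\<lambda>t. \<alpha> t + \<beta> t) has_vector_derivative 0) (at t)" for t
    using has_vector_derivative_add[OF ode(1)[of t] ode(2)[of t]] by (simp flip: scaleR_add_right)
  from vector_derivative_zero_imp_eq[OF this, of _ 0] have sum: "\<alpha> t + \<beta> t = c1" for t
    by (simp add: c1)
  \<comment> \<open>Substituting \<beta> = c1 - \<alpha> into one third of the commutator of
    \<alpha> and \<beta> leaves the commutator of \<alpha> with c1/3, which makes the equation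
    linear.\<close>
  define v where "v = (1 / 3) *\<^sub>R c1"
  have c1Im: "c1 \<in> ImH" and vIm: "v \<in> ImH" using Im by (auto simp: c1 v_def)
  have \<beta>: "\<beta> t = c1 - \<alpha> t" for t using sum[of t] by (simp add: algebra_simps)
  have d\<alpha>: "(\<alpha> has_vector_derivative \<alpha> t * v - v * \<alpha> t) (at t)"
    and d\<beta>: "(\<beta> has_vector_derivative \<beta> t * v - v * \<beta> t) (at t)" for t
    using ode[of t] by (simp_all add: \<beta>[of t] v_def algebra_simps)
  note sx = rotating_frame_solution[OF dx d\<alpha>] and sy = rotating_frame_solution[OF dy d\<beta>]

  \<comment> \<open>Orthogonal decomposition of the initial data\<close>
  have c2_orth: "inner c2 c1 = 0" and c2Im: "c2 \<in> ImH"
    and \<alpha>0: "\<alpha> 0 = ((1 + d1) / 2) *\<^sub>R c1 + (1 / 2) *\<^sub>R c2"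
    and \<beta>0: "\<beta> 0 = ((1 - d1) / 2) *\<^sub>R c1 + (- 1 / 2) *\<^sub>R c2" if "c1 \<noteq> 0"
  proof -
    have "inner c1 c1 \<noteq> 0" using that by simp
    then show "inner c2 c1 = 0"
      using d1[OF that] by (simp add: c2[OF that] inner_diff_left power2_norm_eq_inner)
    show "c2 \<in> ImH" using Im c1Im by (auto simp: c2[OF that])
    show "\<alpha> 0 = ((1 + d1) / 2) *\<^sub>R c1 + (1 / 2) *\<^sub>R c2" "\<beta> 0 = ((1 - d1) / 2) *\<^sub>R c1 + (- 1 / 2) *\<^sub>R c2"
      by (simp_all add: c2[OF that] c1 quat_eq_iff field_simps)
  qed

  \<comment> \<open>Either \<open>v\<close> is 0 or the initial values are multiples of
    \<open>v\<close>; in both cases conjugation by exp (t v) fixes them.\<close>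
  have angular_const: "\<alpha> t = \<alpha> 0 \<and> \<beta> t = \<beta> 0" if "c1 = 0 \<or> c1 \<noteq> 0 \<and> c2 = 0" for t
  proof -
    have *: "exp (- (t *\<^sub>R v)) * (k *\<^sub>R v) * exp (t *\<^sub>R v) = k *\<^sub>R v" for k
    proof -
      have "exp (- (t *\<^sub>R v)) * v * exp (t *\<^sub>R v) = exp (- (t *\<^sub>R v)) * exp (t *\<^sub>R v) * v"
        by (simp only: mult.assoc exp_times_scaleR_commute)
      then show ?thesis using exp_minus_inverse[of "- (t *\<^sub>R v)"] by simp
    qed
    show ?thesis
    proof (cases "c1 = 0")
      case True
      then have "v = 0" by (simp add: v_def)
      then show ?thesis using sx(1)[of t] sy(1)[of t] by simp
    next
      case False
      then have "\<alpha> 0 = (3 * (1 + d1) / 2) *\<^sub>R v" "\<beta> 0 = (3 * (1 - d1) / 2) *\<^sub>R v"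
        using that \<alpha>0 \<beta>0 by (simp_all add: v_def)
      then show ?thesis using sx(1)[of t] sy(1)[of t] * by metis
    qed
  qed

  have part1: "geodesic eucl_product_metric \<gamma> \<longleftrightarrow> c1 = 0 \<or> c1 \<noteq> 0 \<and> c2 = 0"
  proof
    assume L: "geodesic eucl_product_metric \<gamma>"
    have "((\<lambda>t. (\<alpha> t, \<beta> t)) has_vector_derivative 0) (at 0)"
      by (rule eucl_geodesic_ode[OF L]) (use vel Im in auto)
    \<comment> \<open>The nearly Kaehler equation gives a second expression for the derivative of
      \<alpha> at 0; by uniqueness \<open>\<alpha> 0\<close> commutes with \<open>v\<close>.\<close>
    from bounded_linear.has_vector_derivative[OF bounded_linear_fst this]
    have "\<alpha> 0 * v - v * \<alpha> 0 = 0"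
      using vector_derivative_unique_at[OF d\<alpha>[of 0]] by simp
    then have comm: "\<alpha> 0 * c1 = c1 * \<alpha> 0" by (simp add: v_def)
    show "c1 = 0 \<or> c1 \<noteq> 0 \<and> c2 = 0"
    proof (cases "c1 = 0")
      case False
      have c2_eq: "c2 = 2 *\<^sub>R \<alpha> 0 - (1 + d1) *\<^sub>R c1" by (simp add: c2[OF False] c1 scaleR_2 algebra_simps)
      have "c2 * c1 = c1 * c2"
        by (simp only: c2_eq left_diff_distrib right_diff_distrib mult_scaleR_left mult_scaleR_right comm)
      with ImH_orthogonal_commute[OF c2Im[OF False] c1Im c2_orth[OF False]] False
      show ?thesis by simp
    qed simp
  next
    assume R: "c1 = 0 \<or> c1 \<noteq> 0 \<and> c2 = 0"
    note const = angular_const[OF R]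
    show "geodesic eucl_product_metric \<gamma>"
    proof (rule geodesic_euclI[OF smooth])
      fix t
      \<comment> \<open>For constant \<alpha> and \<beta> the acceleration multiplies x and y by the
        squares of imaginary quaternions, which are real, so it is normal to the spheres.\<close>
      have "velocity \<gamma> = (\<lambda>t. (x t * \<alpha> 0, y t * \<beta> 0))" using velocity const by (simp add: fun_eq_iff)
      moreover have "((\<lambda>t. (x t * \<alpha> 0, y t * \<beta> 0)) has_vector_derivative
          (x t * \<alpha> t * \<alpha> 0, y t * \<beta> t * \<beta> 0)) (at t)"
        by (intro has_vector_derivative_Pair has_vector_derivative_mult_left dx dy)
      ultimately have "vector_derivative (velocity \<gamma>) (at t) = (x t * (\<alpha> 0 * \<alpha> 0), y t * (\<beta> 0 * \<beta> 0))"
        using const[of t] by (simp add: vector_derivative_at mult.assoc)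
      then show "tanproj (\<gamma> t) (vector_derivative (velocity \<gamma>) (at t)) = 0"
        using n[of t] by (simp add: \<gamma> tanproj_def ImH_square Im zero_prod_def dot_square_norm)
    qed
  qed

  have P: "nK_P (\<gamma> t) (velocity \<gamma> t) = (x t * \<beta> t, y t * \<alpha> t)" for t
  proof -
    have "inverse (y t) * (y t * \<beta> t) = \<beta> t" "inverse (x t) * (x t * \<alpha> t) = \<alpha> t"
      using n[of t] by (simp_all flip: mult.assoc)
    then show ?thesis by (simp add: nK_P_def \<gamma> velocity[unfolded \<gamma>] mult.assoc)
  qed
  have part2: "(\<forall>t. nK_P (\<gamma> t) (velocity \<gamma> t) = - velocity \<gamma> t) \<longleftrightarrow> c1 = 0"
  proof -
    have "nK_P (\<gamma> t) (velocity \<gamma> t) = - velocity \<gamma> t \<longleftrightarrow> \<beta> t = - \<alpha> t \<and> \<alpha> t = - \<beta> t" for t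
      unfolding P unfolding velocity using n[of t] by (simp flip: mult_minus_right)
    then show ?thesis using sum by (metis add.commute add_eq_0_iff)
  qed
  have part3: "(\<forall>t. nK_P (\<gamma> t) (velocity \<gamma> t) = velocity \<gamma> t) \<longleftrightarrow> c1 \<noteq> 0 \<and> c2 = 0 \<and> d1 = 0"
  proof -
    have eq: "nK_P (\<gamma> t) (velocity \<gamma> t) = velocity \<gamma> t \<longleftrightarrow> \<alpha> t = \<beta> t" for t
      unfolding P unfolding velocity using n[of t] by auto
    show ?thesis unfolding eq
    proof
      assume L: "\<forall>t. \<alpha> t = \<beta> t"
      \<comment> \<open>Non-constancy enters here: \<alpha> = \<beta> together with \<alpha> +
        \<beta> = 0 would make the velocity vanish.\<close>
      have "c1 \<noteq> 0"
      proof
        assume "c1 = 0"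
        then have "2 *\<^sub>R \<alpha> t = 0" for t using sum[of t] L by (simp add: scaleR_2)
        then have "(\<gamma> has_vector_derivative 0) (at t)" for t
          using d\<gamma>[of t] L by (simp add: zero_prod_def)
        from vector_derivative_zero_imp_eq[OF this, of _ 0] have "\<gamma> constant_on UNIV"
          unfolding constant_on_def by blast
        with nonconstant show False by simp
      qed
      moreover from this have "d1 = 0" using L d1 by simp
      ultimately show "c1 \<noteq> 0 \<and> c2 = 0 \<and> d1 = 0" using L c2 by simp
    next
      assume R: "c1 \<noteq> 0 \<and> c2 = 0 \<and> d1 = 0"
      then show "\<forall>t. \<alpha> t = \<beta> t" using angular_const \<alpha>0 \<beta>0 by simp
    qed
  qed

  define u u' where "u = \<alpha> 0 - v" and "u' = \<beta> 0 - v"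
  have uIm: "u \<in> ImH" "u' \<in> ImH" using Im vIm by (auto simp: u_def u'_def)
  have closed: "closed_curve \<gamma> \<longleftrightarrow>
    (\<exists>T>0. exp (T *\<^sub>R u) * exp (T *\<^sub>R v) = 1 \<and> exp (T *\<^sub>R u') * exp (T *\<^sub>R v) = 1)"
  proof -
    have "(\<forall>t. \<gamma> (t + T) = \<gamma> t) \<longleftrightarrow>
      exp (T *\<^sub>R u) * exp (T *\<^sub>R v) = 1 \<and> exp (T *\<^sub>R u') * exp (T *\<^sub>R v) = 1" for T
    proof -
      have "(\<forall>t. \<gamma> (t + T) = \<gamma> t) \<longleftrightarrow> (\<forall>t. x (t + T) = x t) \<and> (\<forall>t. y (t + T) = y t)"
        by (auto simp: \<gamma>)
      also have "(\<forall>t. x (t + T) = x t) \<longleftrightarrow> exp (T *\<^sub>R u) * exp (T *\<^sub>R v) = 1"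
        using exp_product_periodic_iff[OF n(3)[of 0], of T u v] by (simp flip: sx(2) add: u_def)
      also have "(\<forall>t. y (t + T) = y t) \<longleftrightarrow> exp (T *\<^sub>R u') * exp (T *\<^sub>R v) = 1"
        using exp_product_periodic_iff[OF n(4)[of 0], of T u' v] by (simp flip: sy(2) add: u'_def)
      finally show ?thesis .
    qed
    then show ?thesis by (simp add: closed_curve_def)
  qed

  \<comment> \<open>All exponents are parallel to \<open>v\<close>, so the exponentials multiply by
    adding exponents. Only absolute values of \<open>k\<close> and \<open>k'\<close> are prescribed
    because \<open>a\<close> or \<open>a'\<close> may be negative; the cosine does not see the
    sign.\<close>
  have closed_collinear: "closed_curve \<gamma> \<longleftrightarrow> rational_fraction k k'"
    if k: "\<alpha> 0 = r *\<^sub>R v" "\<beta> 0 = r' *\<^sub>R v" "\<bar>k\<bar> = norm (\<alpha> 0)" "\<bar>k'\<bar> = norm (\<beta> 0)" for r r' k k'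
  proof -
    have e: "exp (T *\<^sub>R (s *\<^sub>R v - v)) * exp (T *\<^sub>R v) = exp (T *\<^sub>R (s *\<^sub>R v))" for s T
    proof -
      have "exp (T *\<^sub>R (s *\<^sub>R v - v) + T *\<^sub>R v) = exp (T *\<^sub>R (s *\<^sub>R v - v)) * exp (T *\<^sub>R v)"
        by (rule exp_add_commuting) (simp add: algebra_simps)
      then show ?thesis by (simp add: scaleR_diff_right)
    qed
    have "exp (T *\<^sub>R u) * exp (T *\<^sub>R v) = exp (T *\<^sub>R \<alpha> 0)" "exp (T *\<^sub>R u') * exp (T *\<^sub>R v) = exp (T *\<^sub>R \<beta> 0)" for T
      using e[of T r] e[of T r'] by (simp_all only: u_def u'_def k)
    then have "closed_curve \<gamma> \<longleftrightarrow> (\<exists>T>0. exp (T *\<^sub>R \<alpha> 0) = 1 \<and> exp (T *\<^sub>R \<beta> 0) = 1)"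
      using closed by simp
    also have "\<dots> \<longleftrightarrow> (\<exists>T>0. cos (T * k) = 1 \<and> cos (T * k') = 1)"
    proof -
      have "cos (T * \<bar>s\<bar>) = cos (T * s)" for T s :: real by (cases "s \<ge> 0") simp_all
      then have "exp (T *\<^sub>R \<alpha> 0) = 1 \<longleftrightarrow> cos (T * k) = 1" "exp (T *\<^sub>R \<beta> 0) = 1 \<longleftrightarrow> cos (T * k') = 1" if "T > 0" for T
        using exp_scaleR_ImH_eq_1_iff[OF Im(1)[of 0] that] exp_scaleR_ImH_eq_1_iff[OF Im(2)[of 0] that] k(3,4) by metis+
      then show ?thesis by metis
    qed
    finally show ?thesis by (simp add: rational_fraction_iff_common_period)
  qed

  have part4: "closed_curve \<gamma> \<longleftrightarrow> c1 = 0
       \<or> (c1 \<noteq> 0 \<and> c2 = 0 \<and> rational_fraction a a')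
       \<or> (c1 \<noteq> 0 \<and> c2 \<noteq> 0 \<and> rational_fraction B A \<and> rational_fraction B' A')"
  proof -
    consider "c1 = 0" | "c1 \<noteq> 0" "c2 = 0" | "c1 \<noteq> 0" "c2 \<noteq> 0" by blast
    then show ?thesis
    proof cases
      case 1
      then have "v = 0" "\<beta> 0 = - \<alpha> 0" using \<beta>[of 0] by (simp_all add: v_def)
      then have "closed_curve \<gamma> \<longleftrightarrow>
          (\<exists>T>0. cos (T * norm (\<alpha> 0)) = 1 \<and> cos (T * norm (\<alpha> 0)) = 1)"
        using exp_scaleR_ImH_eq_1_iff[OF Im(1)[of 0]] exp_scaleR_ImH_eq_1_iff[OF Im(2)[of 0]]
        by (auto simp: closed u_def u'_def)
      \<comment> \<open>Both components have the same frequency, and a fraction with equal entries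
        always satisfies the criterion, so a positive period exists.\<close>
      moreover have "rational_fraction r r" for r by (simp add: rational_fraction_def)
      ultimately show ?thesis using 1 by (simp add: rational_fraction_iff_common_period)
    next
      case 2
      have "\<alpha> 0 = (3 * (1 + d1) / 2) *\<^sub>R v" "\<beta> 0 = (3 * (1 - d1) / 2) *\<^sub>R v"
        "\<bar>a\<bar> = norm (\<alpha> 0)" "\<bar>a'\<bar> = norm (\<beta> 0)"
        using 2 \<alpha>0 \<beta>0 by (simp_all add: v_def a[OF 2(1)] a'[OF 2(1)] abs_mult)
      from closed_collinear[OF this] show ?thesis using 2 by simp
    next
      case 3
      note orth = c2_orth[OF 3(1)]
      have v0: "v \<noteq> 0" using 3 by (simp add: v_def)
      have u: "u = (1 / 6 + d1 / 2) *\<^sub>R c1 + (1 / 2) *\<^sub>R c2"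
        and u': "u' = (1 / 6 - d1 / 2) *\<^sub>R c1 + (- 1 / 2) *\<^sub>R c2"
        unfolding u_def u'_def \<alpha>0[OF 3(1)] \<beta>0[OF 3(1)] v_def
        by (simp_all add: quat_eq_iff add_divide_distrib diff_divide_distrib algebra_simps)
      \<comment> \<open>Pairing with \<open>c2\<close> annihilates \<open>c1\<close> and
        \<open>v\<close> and leaves l times the squared norm of \<open>c2\<close>.\<close>
      have ind: "k *\<^sub>R c1 + l *\<^sub>R c2 \<noteq> r *\<^sub>R v" if "l \<noteq> 0" for k l r
      proof
        assume "k *\<^sub>R c1 + l *\<^sub>R c2 = r *\<^sub>R v"
        then have "inner (k *\<^sub>R c1 + l *\<^sub>R c2) c2 = inner (r *\<^sub>R v) c2" by simp
        then show False
          using orth that 3(2) by (simp add: v_def inner_add_left inner_commute[of c1])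
      qed
      have indu: "u \<noteq> r *\<^sub>R v" "u' \<noteq> r *\<^sub>R v" for r unfolding u u' by (rule ind; simp)+
      then have pos: "norm u > 0" "norm u' > 0" "norm v > 0" using v0 indu[of 0] by auto
      have "closed_curve \<gamma> \<longleftrightarrow> norm u / norm v \<in> \<rat> \<and> norm u' / norm v \<in> \<rat>"
        unfolding common_period_iff[OF pos, symmetric] closed
        using exp_mult_exp_eq_1_iff[OF uIm(1) vIm _ v0 indu(1)] exp_mult_exp_eq_1_iff[OF uIm(2) vIm _ v0 indu(2)]
        by (auto cong: conj_cong)
      moreover have nv: "c / 2 = norm v" "c' / 2 = norm v" using c[OF 3(1)] c'[OF 3(1)] by (simp_all add: v_def)
      \<comment> \<open>Since 2 u = (1/3 + d1) c1 + c2 with orthogonal summands, both sides equal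
        (1/3 + d1)^2 |c1|^2 + |c2|^2. Thus \<open>A\<close> and \<open>B\<close> are the sum and the
        difference of the norms of \<open>v\<close> and \<open>u\<close>.\<close>
      have "(2 * a - c)\<^sup>2 + 4 * b\<^sup>2 = (2 * norm u)\<^sup>2"
        unfolding u power_mult_distrib norm_orthogonal_combination[OF orth] a[OF 3(1)] b[OF 3(1)] c[OF 3(1)]
        by (simp add: power2_eq_square field_simps)
      then have "sqrt ((2 * a - c)\<^sup>2 + 4 * b\<^sup>2) = 2 * norm u"
        by (simp only: real_sqrt_abs) simp
      then have "A = norm v + norm u" "B = norm v - norm u"
        unfolding A[OF 3(1)] B[OF 3(1)] by (simp_all add: add_divide_distrib diff_divide_distrib nv)
      moreover have "(2 * a' - c')\<^sup>2 + 4 * b'\<^sup>2 = (2 * norm u')\<^sup>2"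
        unfolding u' power_mult_distrib norm_orthogonal_combination[OF orth] a'[OF 3(1)] b'[OF 3(1)] c'[OF 3(1)]
        by (simp add: power2_eq_square field_simps)
      then have "sqrt ((2 * a' - c')\<^sup>2 + 4 * b'\<^sup>2) = 2 * norm u'"
        by (simp only: real_sqrt_abs) simp
      then have "A' = norm v + norm u'" "B' = norm v - norm u'"
        unfolding A'[OF 3(1)] B'[OF 3(1)] by (simp_all add: add_divide_distrib diff_divide_distrib nv)
      ultimately show ?thesis
        using 3 pos by (simp add: rational_fraction_diff_sum_iff)
    qed
  qed
  show ?thesis using part1 part2 part3 part4 by blast
qed

end
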